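(* Let $d$ and $r_1,\dots,r_d$ be positive integers, $r=r_1+\cdots+r_d$, and let $\boldsymbol{s}=(s_{1,1},\dots,s_{1,r_1},\dots,s_{d,1},\dots,s_{d,r_d})\in W(r_1,\dots,r_d)$. Then \[ \sum_{i=1}^{d}\sum_{j=1}^{r_i}\widetilde\zeta_{i,j}(\boldsymbol{s})=\sum_{i=1}^{d}\zeta^{\mathrm{C}}_i(\boldsymbol{s}), \] where \[ \widetilde\zeta_{i,j}(\boldsymbol{s}):=\sum_{S_{i,j}}\left(\frac{n_{i,r_i}^{\delta_{j,r_i}}}{\boldsymbol{n}^{\boldsymbol{s}}\,n^{\delta_{j,r_i}}\,(n-n_{i,j})}-\frac{n_{i,j}^{s_{i,j}}}{\boldsymbol{n}^{\boldsymbol{s}}\,n^{s_{i,j}}\,(n-n_{i,j})}\right),\qquad \zeta^{\mathrm{C}}_i(\boldsymbol{s}):=\sum_{S_i}\frac{1}{\boldsymbol{n}^{\boldsymbol{s}}\,n}. \]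
   Context: Notation: for positive integers $n_{i,j}$ ($1\le i\le d$, $1\le j\le r_i$) and complex $s_{i,j}$, write $\boldsymbol{n}^{\boldsymbol{s}}:=\prod_{i=1}^d\prod_{j=1}^{r_i}n_{i,j}^{s_{i,j}}$; $\delta_{j,r_i}$ is the Kronecker delta. First indices are read cyclically modulo $d$ (so index $0$ means $d$ and index $d+1$ means $1$), and $n_{i,r_i+1}:=\infty$. The domain $W=W(r_1,\dots,r_d)\subset\mathbb{C}^r$: if $(r_1,\dots,r_d)\neq(1,\dots,1)$, $W$ is the set of $\boldsymbol{s}$ such that for every $i$ with $r_i\ne1$: $\Re(s_{i,r_i})>1$, $\Re(s_{i,r_i-1})+\Re(s_{i,r_i})>2,\dots,\Re(s_{i,1})+\cdots+\Re(s_{i,r_i})>r_i$; and for every $i$ with $r_i=1$: $\Re(s_{i,1})\ge1$. If $r_1=\cdots=r_d=1$, $W$ is the set of $\boldsymbol{s}$ with $\Re(s_{1,1}+\cdots+s_{d,1})>d$ and $\Re(s_{l,1}+s_{l+1,1}+\cdots+s_{l+k,1})>k$ for all $1\le l\le d$, $0\le k\le d-2$ (indices mod $d$). Summation sets (tuples $(n_{1,1},\dots,n_{d,r_d},n)\in\mathbb{Z}_{\ge1}^{r+1}$): $S_{i,j}$: $n_{k,1}<n_{k,2}<\cdots<n_{k,r_k}$ for all $k$; $n_{k,1}\le n_{k+1,r_{k+1}}$ for all $k\in\{1,\dots,d\}$ with $k\not\equiv i-1\pmod d$; $n_{i-1,1}\le\max\{n_{i,r_i},n\}$; and $n_{i,j}<n<n_{i,j+1}$.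 $S_i$: $n_{k,1}<\cdots<n_{k,r_k}$ for all $k$; $n_{k,1}\le n_{k+1,r_{k+1}}$ for all $k=1,\dots,d$; and $n_{i,1}\le n\le n_{i+1,r_{i+1}}$. *)

theory Defs
  imports "HOL-Analysis.Analysis"
begin

text \<open>
  Families indexed by pairs \<open>(i,j)\<close> with \<open>1 \<le> i \<le> d\<close>, \<open>1 \<le> j \<le> r i\<close> are functions on
  \<^typ>\<open>nat \<times> nat\<close>. The tuples that are summed over are extensional outside the index set,
  so that each tuple is counted exactly once.
\<close>

definition idx :: "nat \<Rightarrow> (nat \<Rightarrow> nat) \<Rightarrow> (nat \<times> nat) set" where
  "idx d r = (SIGMA i:{1..d}. {1..r i})"

text \<open>Representative in \<open>{1..d}\<close> modulo \<open>d\<close>; in particular \<open>0\<close> is read as \<open>d\<close> and \<open>d + 1\<close> as \<open>1\<close>.\<close>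

definition cyc :: "nat \<Rightarrow> nat \<Rightarrow> nat" where
  "cyc d m = (if m mod d = 0 then d else m mod d)"

text \<open>In the second case \<open>k + 2 \<le> d\<close> is \<open>k \<le> d - 2\<close> without truncated subtraction.\<close>

definition W :: "nat \<Rightarrow> (nat \<Rightarrow> nat) \<Rightarrow> (nat \<times> nat \<Rightarrow> complex) set" where
  "W d r =
    (if \<exists>i\<in>{1..d}. r i \<noteq> 1 then
       {s. \<forall>i\<in>{1..d}.
          (r i \<noteq> 1 \<longrightarrow> (\<forall>j\<in>{1..r i}. (\<Sum>l=j..r i. Re (s (i,l))) > real (r i + 1 - j))) \<and>
          (r i = 1 \<longrightarrow> Re (s (i,1)) \<ge> 1)}
     else
       {s. Re (\<Sum>i=1..d. s (i,1)) > real d \<and>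
          (\<forall>l\<in>{1..d}. \<forall>k. k + 2 \<le> d \<longrightarrow> Re (\<Sum>m=0..k. s (cyc d (l + m), 1)) > real k)})"

definition increasing_tuples :: "nat \<Rightarrow> (nat \<Rightarrow> nat) \<Rightarrow> (nat \<times> nat \<Rightarrow> nat) set" where
  "increasing_tuples d r =
    {ns \<in> idx d r \<rightarrow>\<^sub>E {1..}. \<forall>k\<in>{1..d}. strict_mono_on {1..r k} (\<lambda>j. ns (k,j))}"

text \<open>The convention \<open>n\<^bsub>i,r i + 1\<^esub> = \<infinity>\<close> is the guard \<open>j < r i\<close> in the last condition.\<close>

definition S_tilde :: "nat \<Rightarrow> (nat \<Rightarrow> nat) \<Rightarrow> nat \<Rightarrow> nat \<Rightarrow> ((nat \<times> nat \<Rightarrow> nat) \<times> nat) set" where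
  "S_tilde d r i j =
    {(ns, n). ns \<in> increasing_tuples d r \<and> n \<ge> 1 \<and>
       (\<forall>k\<in>{1..d}. k mod d \<noteq> (i - 1) mod d \<longrightarrow>
          ns (k,1) \<le> ns (cyc d (k + 1), r (cyc d (k + 1)))) \<and>
       ns (cyc d (i - 1), 1) \<le> max (ns (i, r i)) n \<and>
       ns (i,j) < n \<and> (j < r i \<longrightarrow> n < ns (i, j + 1))}"

definition S_cyc :: "nat \<Rightarrow> (nat \<Rightarrow> nat) \<Rightarrow> nat \<Rightarrow> ((nat \<times> nat \<Rightarrow> nat) \<times> nat) set" where
  "S_cyc d r i =
    {(ns, n). ns \<in> increasing_tuples d r \<and> n \<ge> 1 \<and>
       (\<forall>k\<in>{1..d}. ns (k,1) \<le> ns (cyc d (k + 1), r (cyc d (k + 1)))) \<and>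
       ns (i,1) \<le> n \<and> n \<le> ns (cyc d (i + 1), r (cyc d (i + 1)))}"

definition multi_power ::
    "nat \<Rightarrow> (nat \<Rightarrow> nat) \<Rightarrow> (nat \<times> nat \<Rightarrow> nat) \<Rightarrow> (nat \<times> nat \<Rightarrow> complex) \<Rightarrow> complex" where
  "multi_power d r ns s = (\<Prod>i=1..d. \<Prod>j=1..r i. of_nat (ns (i,j)) powr s (i,j))"

text \<open>The exponent \<^term>\<open>of_bool (j = r i) :: nat\<close> is the Kronecker delta.\<close>

definition zeta_tilde_term ::
    "nat \<Rightarrow> (nat \<Rightarrow> nat) \<Rightarrow> (nat \<times> nat \<Rightarrow> complex) \<Rightarrow> nat \<Rightarrow> nat \<Rightarrow>
     (nat \<times> nat \<Rightarrow> nat) \<times> nat \<Rightarrow> complex" where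
  "zeta_tilde_term d r s i j = (\<lambda>(ns, n).
     of_nat (ns (i, r i)) ^ (of_bool (j = r i) :: nat) /
       (multi_power d r ns s * of_nat n ^ (of_bool (j = r i) :: nat) *
        (of_nat n - of_nat (ns (i,j))))
     - of_nat (ns (i,j)) powr s (i,j) /
       (multi_power d r ns s * of_nat n powr s (i,j) * (of_nat n - of_nat (ns (i,j)))))"

definition zeta_tilde ::
    "nat \<Rightarrow> (nat \<Rightarrow> nat) \<Rightarrow> (nat \<times> nat \<Rightarrow> complex) \<Rightarrow> nat \<Rightarrow> nat \<Rightarrow> complex" where
  "zeta_tilde d r s i j = (\<Sum>\<^sub>\<infinity>x\<in>S_tilde d r i j. zeta_tilde_term d r s i j x)"

definition zeta_cyc_term ::
    "nat \<Rightarrow> (nat \<Rightarrow> nat) \<Rightarrow> (nat \<times> nat \<Rightarrow> complex) \<Rightarrow> (nat \<times> nat \<Rightarrow> nat) \<times> nat \<Rightarrow> complex" where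
  "zeta_cyc_term d r s = (\<lambda>(ns, n). 1 / (multi_power d r ns s * of_nat n))"

definition zeta_cyc ::
    "nat \<Rightarrow> (nat \<Rightarrow> nat) \<Rightarrow> (nat \<times> nat \<Rightarrow> complex) \<Rightarrow> nat \<Rightarrow> complex" where
  "zeta_cyc d r s i = (\<Sum>\<^sub>\<infinity>x\<in>S_cyc d r i. zeta_cyc_term d r s x)"

end

theory Submission
  imports Defs
begin

text \<open>
  Write \<open>a = n\<^bsub>i,1\<^esub>\<close> and \<open>b = n\<^bsub>i+1,r\<^esub>\<close> with \<open>r = r\<^bsub>i+1\<^esub>\<close>, and split every \<open>S\<^bsub>i,j\<^esub>\<close>-summand
  into its two fractions. In the second fraction exchange \<open>n\<close> and \<open>n\<^bsub>i,j\<^esub>\<close>: it becomes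
  \<open>1 / (n\<^bsub>i,j\<^esub> - n)\<close> times the common weight \<open>1 / n\<^sup>s\<close>, and reflecting the range of \<open>n\<close> shows that
  the second sum for \<open>j + 1\<close> cancels the first sum for \<open>j\<close>. For each \<open>i\<close> there remain the first sum
  for \<open>j = r\<^bsub>i\<^esub>\<close>, which belongs to the link from block \<open>i - 1\<close> to block \<open>i\<close>, and the second sum for
  \<open>j = 1\<close>, which belongs to the link from \<open>i\<close> to \<open>i + 1\<close>. Collecting the two contributions of one
  link, the inner sums over \<open>n\<close> are finite differences of harmonic numbers whose difference is
  \<open>H\<^sub>b - H\<^bsub>a-1\<^esub>\<close> if \<open>a \<le> b\<close> and \<open>0\<close> otherwise, and this is the inner sum over \<open>S\<^sub>i\<close>.

  All rearrangements are justified by one estimate. After summation over \<open>n\<close> every term is at most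
  \<open>(1 + H\<^sub>b) min 1 (b / a)\<close> times the absolute weight. In the logarithms of the variables the weight
  and the factors \<open>min 1 (b / a)\<close> are piecewise linear, and linear along level sets (a coarea
  formula); so it suffices to look at indicator functions of sets that are upward closed in each
  block, and for these the required inequality is exactly what membership in \<open>W\<close> says. As finitely
  many strict inequalities leave room for some \<open>\<eta> > 0\<close>, the terms are dominated by the product of
  the \<open>n\<^sub>v powr (- 1 - \<eta> / 2)\<close> over all indices \<open>v\<close>.
\<close>

subsection \<open>Summation over dependent products\<close>

text \<open>A finite set of tuples sits in the box spanned by its coordinate projections; there the
  sum of products factors, and each factor is at most the total sum over \<open>B v\<close>.\<close>

lemma summable_on_prod_PiE:
  fixes f :: "'a \<Rightarrow> 'b \<Rightarrow> real"
  assumes fin: "finite V"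
    and summ: "\<And>v. v \<in> V \<Longrightarrow> f v summable_on B v"
    and nonneg: "\<And>v y. v \<in> V \<Longrightarrow> y \<in> B v \<Longrightarrow> f v y \<ge> 0"
  shows "(\<lambda>g. \<Prod>v\<in>V. f v (g v)) summable_on PiE V B"
proof (rule nonneg_bdd_above_summable_on)
  show "(\<Prod>v\<in>V. f v (g v)) \<ge> 0" if "g \<in> PiE V B" for g
    using that nonneg by (intro prod_nonneg) (auto simp: PiE_iff)
  show "bdd_above (sum (\<lambda>g. \<Prod>v\<in>V. f v (g v)) ` {F. F \<subseteq> PiE V B \<and> finite F})"
  proof (rule bdd_aboveI2)
    fix F assume "F \<in> {F. F \<subseteq> PiE V B \<and> finite F}"
    then have F: "F \<subseteq> PiE V B" "finite F" by auto
    define C where "C v = (\<lambda>g. g v) ` F" for v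
    have C: "finite (C v)" for v using F by (simp add: C_def)
    have CB: "C v \<subseteq> B v" if "v \<in> V" for v using F that by (auto simp: C_def)
    have FC: "F \<subseteq> PiE V C"
      using F by (auto simp: C_def PiE_iff)
    have "(\<Sum>g\<in>F. \<Prod>v\<in>V. f v (g v)) \<le> (\<Sum>g\<in>PiE V C. \<Prod>v\<in>V. f v (g v))"
    proof (rule sum_mono2)
      show "F \<subseteq> PiE V C" by (rule FC)
      show "finite (PiE V C)" using fin C by (simp add: finite_PiE)
      show "0 \<le> (\<Prod>v\<in>V. f v (g v))" if "g \<in> PiE V C - F" for g
      proof (rule prod_nonneg)
        fix v assume v: "v \<in> V"
        then have "g v \<in> B v" using that CB[OF v] by (auto simp: PiE_iff)
        then show "0 \<le> f v (g v)" by (rule nonneg[OF v])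
      qed
    qed
    also have "\<dots> = (\<Prod>v\<in>V. \<Sum>y\<in>C v. f v y)"
      using C fin by (subst prod_sum_PiE) auto
    also have "\<dots> \<le> (\<Prod>v\<in>V. infsum (f v) (B v))"
    proof (intro prod_mono conjI)
      fix v assume v: "v \<in> V"
      show "0 \<le> (\<Sum>y\<in>C v. f v y)"
        using CB[OF v] nonneg[OF v] by (intro sum_nonneg) blast
      show "(\<Sum>y\<in>C v. f v y) \<le> infsum (f v) (B v)"
        using C CB[OF v] nonneg[OF v] summ[OF v] by (intro finite_sum_le_infsum) auto
    qed
    finally show "(\<Sum>g\<in>F. \<Prod>v\<in>V. f v (g v)) \<le> (\<Prod>v\<in>V. infsum (f v) (B v))" .
  qed
qed

text \<open>Every sum below has this shape: a complex weight times a nonnegative kernel with known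
  sum over \<open>n\<close>. Nonnegativity turns the inner absolute sum into
  \<open>norm (f x) * h x\<close>, so summability over the base gives absolute convergence on the
  fibration.\<close>

lemma has_sum_Sigma_weighted:
  fixes f :: "'a \<Rightarrow> complex" and g :: "'a \<Rightarrow> 'b \<Rightarrow> real"
  assumes g: "\<And>x. x \<in> T \<Longrightarrow> (g x has_sum h x) (N x)"
    and nonneg: "\<And>x y. x \<in> T \<Longrightarrow> y \<in> N x \<Longrightarrow> g x y \<ge> 0"
    and summ: "(\<lambda>x. norm (f x) * h x) summable_on T"
  shows "((\<lambda>(x, y). f x * of_real (g x y)) has_sum (\<Sum>\<^sub>\<infinity>x\<in>T. f x * of_real (h x))) (Sigma T N)"
proof (rule has_sum_SigmaI)
  have h: "h x \<ge> 0" if "x \<in> T" for x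
    using has_sum_nonneg[OF g[OF that] nonneg[OF that]] .
  have "(\<lambda>x. norm (f x * complex_of_real (h x))) summable_on T \<longleftrightarrow> (\<lambda>x. norm (f x) * h x) summable_on T"
    by (rule summable_on_cong) (simp add: norm_mult h)
  then have "(\<lambda>x. norm (f x * complex_of_real (h x))) summable_on T" using summ by (rule iffD2)
  then show "((\<lambda>x. f x * of_real (h x)) has_sum (\<Sum>\<^sub>\<infinity>x\<in>T. f x * of_real (h x))) T"
    by (rule has_sum_infsum[OF abs_summable_summable])
  show "((\<lambda>y. case (x, y) of (x, y) \<Rightarrow> f x * of_real (g x y)) has_sum f x * of_real (h x)) (N x)"
    if "x \<in> T" for x
    unfolding prod.case by (intro has_sum_cmult_right has_sum_of_real g that)
  have "(\<lambda>(x, y). norm (f x) * g x y) summable_on Sigma T N"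
  proof (rule summable_on_SigmaI)
    show "((\<lambda>y. case (x, y) of (x, y) \<Rightarrow> norm (f x) * g x y) has_sum norm (f x) * h x) (N x)"
      if "x \<in> T" for x
      unfolding prod.case by (intro has_sum_cmult_right g that)
  qed (use summ nonneg in auto)
  moreover have "(\<lambda>p. norm (case p of (x, y) \<Rightarrow> f x * complex_of_real (g x y))) summable_on Sigma T N
      \<longleftrightarrow> (\<lambda>(x, y). norm (f x) * g x y) summable_on Sigma T N"
    by (rule summable_on_cong) (auto simp: norm_mult nonneg)
  ultimately have "(\<lambda>p. norm (case p of (x, y) \<Rightarrow> f x * complex_of_real (g x y))) summable_on Sigma T N"
    by simp
  then show "(\<lambda>(x, y). f x * of_real (g x y)) summable_on Sigma T N"
    by (rule abs_summable_summable)
qed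

subsection \<open>Differences of harmonic numbers\<close>

lemma harm_diff_eq_sum:
  assumes "b \<le> m"
  shows "harm m - harm (m - b) = (\<Sum>j=1..b. 1 / real (m - b + j))"
proof -
  have "harm (c + b) - harm c = (\<Sum>j=1..b. 1 / real (c + j))" for c
    by (induction b) (auto simp: harm_Suc field_simps)
  from this[of "m - b"] assms show ?thesis by simp
qed

text \<open>
  The inner sums over \<open>n\<close> belonging to one link, see \<open>has_sum_upper_gap\<close> and \<open>has_sum_lower_gap\<close>.
  The truncated subtraction in \<open>lower_gap\<close> is intended: it yields \<open>H\<^bsub>a-1\<^esub>\<close> if \<open>a \<le> b\<close>.
\<close>

definition upper_gap :: "nat \<Rightarrow> nat \<Rightarrow> real" where
  "upper_gap a b = harm (max (a - 1) b) - harm (max (a - 1) b - b)"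

definition lower_gap :: "nat \<Rightarrow> nat \<Rightarrow> real" where
  "lower_gap a b = harm (a - 1) - harm (a - 1 - b)"

lemma lower_gap_le_upper_gap: "lower_gap a b \<le> upper_gap a b"
  by (auto simp: upper_gap_def lower_gap_def max_def harm_expand intro: harm_mono)

lemma lower_gap_nonneg: "lower_gap a b \<ge> 0"
  by (auto simp: lower_gap_def intro!: harm_mono)

lemma upper_gap_nonneg: "upper_gap a b \<ge> 0"
  using lower_gap_nonneg lower_gap_le_upper_gap order_trans by blast

lemma upper_gap_diff_lower_gap:
  "upper_gap a b - lower_gap a b = (if a \<le> b then harm b - harm (a - 1) else 0)"
proof (cases "a \<le> b")
  case False
  then have "max (a - 1) b = a - 1" by simp
  then show ?thesis using False by (simp add: upper_gap_def lower_gap_def)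
qed (auto simp: upper_gap_def lower_gap_def max_def harm_expand)

lemma upper_gap_eq_harm: "a \<le> b \<Longrightarrow> upper_gap a b = harm b"
  by (simp add: upper_gap_def max_def harm_expand)

text \<open>If \<open>a > b\<close>, the gap consists of \<open>b\<close> reciprocals
  \<open>1 / m\<close> with \<open>m = a - 1 - b + j\<close>. As \<open>a \<le> m + b\<close> and
  \<open>m \<ge> j\<close>, the quotient \<open>a / m\<close> is at most \<open>1 + b / j\<close>,
  and summing over \<open>j\<close> produces \<open>b * (1 + harm b)\<close>.\<close>

lemma upper_gap_le:
  assumes "a \<ge> 1" "b \<ge> 1"
  shows "upper_gap a b \<le> (1 + harm b) * min 1 (real b / real a)"
proof (cases "a \<le> b")
  case True
  then show ?thesis using assms by (simp add: upper_gap_eq_harm)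
next
  case False
  then have b: "b \<le> a - 1" by simp
  have "real a * upper_gap a b = (\<Sum>j=1..b. real a / real (a - 1 - b + j))"
    using harm_diff_eq_sum[OF b] b by (simp add: upper_gap_def max_absorb1 sum_distrib_left)
  also have "\<dots> \<le> (\<Sum>j=1..b. 1 + real b * (1 / real j))"
  proof (rule sum_mono)
    fix j assume j: "j \<in> {1..b}"
    have "real a \<le> real (a - 1 - b + j) + real b"
    proof -
      have "a \<le> (a - 1 - b + j) + b" using j b assms by (auto simp: le_diff_conv)
      then show ?thesis by (metis of_nat_add of_nat_mono)
    qed
    then have "real a / real (a - 1 - b + j) \<le> (real (a - 1 - b + j) + real b) / real (a - 1 - b + j)"
      by (intro divide_right_mono) auto
    also have "\<dots> = 1 + real b / real (a - 1 - b + j)"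
      using j by (simp add: add_divide_distrib)
    also have "real b / real (a - 1 - b + j) \<le> real b * (1 / real j)"
      using j by (simp add: frac_le)
    finally show "real a / real (a - 1 - b + j) \<le> 1 + real b * (1 / real j)" by simp
  qed
  also have "\<dots> = real b * (1 + harm b)"
    by (simp add: sum.distrib sum_distrib_left harm_def inverse_eq_divide algebra_simps)
  finally have "upper_gap a b \<le> (1 + harm b) * (real b / real a)"
    using assms by (simp add: field_simps)
  then show ?thesis using False by (simp add: min_def)
qed

lemma has_sum_lower_gap:
  "((\<lambda>n. 1 / (real a - real n)) has_sum lower_gap a b) {n. 1 \<le> n \<and> n < a \<and> n \<le> b}"
proof -
  define c where "c = min (a - 1) b"
  have S: "{n. 1 \<le> n \<and> n < a \<and> n \<le> b} = {1..c}" by (auto simp: c_def)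
  have "(\<Sum>n\<in>{1..c}. 1 / (real a - real n)) = (\<Sum>j=1..c. 1 / real (a - 1 - c + j))"
    by (rule sum.reindex_bij_witness[of _ "\<lambda>j. c + 1 - j" "\<lambda>j. c + 1 - j"])
       (auto simp: c_def of_nat_diff min_def split: if_splits)
  also have "\<dots> = harm (a - 1) - harm (a - 1 - c)"
    by (rule harm_diff_eq_sum[symmetric]) (simp add: c_def)
  \<comment> \<open>Truncated subtraction: when \<open>a - 1 \<le> b\<close>, both sides are
    \<open>0\<close>.\<close>
  also have "a - 1 - c = a - 1 - b" by (auto simp: c_def)
  finally show ?thesis
    unfolding S lower_gap_def by (simp add: has_sum_finite_iff)
qed

text \<open>Partial fractions: the summand is \<open>1 / (n - b) - 1 / n\<close>, hence the series
  telescopes over windows of \<open>b\<close> consecutive reciprocals.\<close>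

lemma has_sum_upper_gap:
  assumes "b \<ge> 1"
  shows "((\<lambda>n. real b / (real n * (real n - real b))) has_sum upper_gap a b) {n. a \<le> n \<and> b < n}"
proof -
  define c where "c = max a (b + 1)"
  \<comment> \<open>\<open>u k\<close> is the window ending at \<open>c + k - 1\<close>, with
    \<open>c\<close> the least admissible \<open>n\<close>; it will be the tail of the series from
    \<open>n = c + k\<close> on. Its denominators are at least \<open>k + 1\<close>, so it tends to
    \<open>0\<close>.\<close>
  define u where "u k = harm (c + k - 1) - (harm (c + k - 1 - b) :: real)" for k
  have cb: "b < c" by (simp add: c_def)
  have u_eq: "u k = (\<Sum>j=1..b. 1 / real (c + k - 1 - b + j))" for k
    unfolding u_def by (rule harm_diff_eq_sum) (use cb in simp)
  have u_le: "u k \<le> real b * (1 / real (k + 1))" for k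
  proof -
    have "u k \<le> (\<Sum>j=1..b. 1 / real (k + 1))"
      unfolding u_eq using cb by (intro sum_mono divide_left_mono) auto
    then show ?thesis by simp
  qed
  have u_ge: "u k \<ge> 0" for k
    unfolding u_eq by (intro sum_nonneg) auto
  have "(\<lambda>k. real b * (1 / real (k + 1))) \<longlonglongrightarrow> real b * 0"
    by (intro tendsto_mult tendsto_const) (use LIMSEQ_inverse_real_of_nat in \<open>simp add: inverse_eq_divide add_ac\<close>)
  then have "u \<longlonglongrightarrow> 0"
    using u_le u_ge by (intro tendsto_sandwich[where f = "\<lambda>_. 0" and g = u]) auto
  then have "(\<lambda>k. u k - u (Suc k)) sums (u 0 - 0)"
    by (rule telescope_sums')
  also have "(\<lambda>k. u k - u (Suc k)) = (\<lambda>k. real b / (real (c + k) * (real (c + k) - real b)))"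
  proof
    fix k
    have "harm (c + k) = harm (c + k - 1) + (1 / real (c + k) :: real)"
      using cb harm_Suc[of "c + k - 1", where ?'a = real] by (simp add: inverse_eq_divide)
    moreover have "harm (c + k - b) = harm (c + k - 1 - b) + (1 / real (c + k - b) :: real)"
      using cb harm_Suc[of "c + k - 1 - b", where ?'a = real]
      by (simp add: inverse_eq_divide Suc_diff_Suc)
    ultimately have "u k - u (Suc k) = 1 / (real (c + k) - real b) - 1 / real (c + k)"
      using cb by (simp add: u_def of_nat_diff)
    also have "\<dots> = real b / (real (c + k) * (real (c + k) - real b))"
      using cb by (simp add: field_simps)
    finally show "u k - u (Suc k) = real b / (real (c + k) * (real (c + k) - real b))" .
  qed
  finally have "((\<lambda>k. real b / (real (c + k) * (real (c + k) - real b))) has_sum u 0) UNIV"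
    using cb by (intro sums_nonneg_imp_has_sum) auto
  moreover have "u 0 = upper_gap a b"
    by (auto simp: u_def upper_gap_def c_def max_def)
  moreover have "bij_betw (\<lambda>k. c + k) UNIV {n. a \<le> n \<and> b < n}"
    by (rule bij_betwI[where g = "\<lambda>n. n - c"]) (auto simp: c_def)
  ultimately show ?thesis
    using has_sum_reindex_bij_betw[of "\<lambda>k. c + k" UNIV "{n. a \<le> n \<and> b < n}"
        "\<lambda>n. real b / (real n * (real n - real b))" "upper_gap a b"] by simp
qed

subsection \<open>Inequalities on level sets\<close>

text \<open>
  Both sides are linear along the decomposition of \<open>x\<close> into its level sets \<open>{v. x v > t}\<close>, so the
  inequality for these sets suffices. The induction peels off the lowest positive level.
\<close>

lemma weighted_sum_le_cut_sum:
  fixes w x :: "'a \<Rightarrow> real"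
  assumes fin: "finite V" "finite I"
    and ab: "\<And>k. k \<in> I \<Longrightarrow> \<alpha> k \<in> V \<and> \<beta> k \<in> V"
    and R: "R \<subseteq> V \<times> V"
    and cut: "\<And>A. A \<subseteq> V \<Longrightarrow> (\<And>u v. (u, v) \<in> R \<Longrightarrow> u \<in> A \<Longrightarrow> v \<in> A) \<Longrightarrow>
      sum w A \<le> card {k \<in> I. \<alpha> k \<in> A \<and> \<beta> k \<notin> A}"
    and nonneg: "\<And>v. v \<in> V \<Longrightarrow> x v \<ge> 0"
    and mono: "\<And>u v. (u, v) \<in> R \<Longrightarrow> x u \<le> x v"
  shows "(\<Sum>v\<in>V. w v * x v) \<le> (\<Sum>k\<in>I. max 0 (x (\<alpha> k) - x (\<beta> k)))"
  using nonneg mono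
proof (induction "card {v \<in> V. x v > 0}" arbitrary: x rule: less_induct)
  case less
  define A where "A = {v \<in> V. x v > 0}"
  have finA: "finite A" using fin by (simp add: A_def)
  show ?case
  proof (cases "A = {}")
    case True
    then have "x v = 0" if "v \<in> V" for v
      using less.prems(1) that unfolding A_def by force
    then have "(\<Sum>v\<in>V. w v * x v) = 0" by simp
    also have "0 \<le> (\<Sum>k\<in>I. max 0 (x (\<alpha> k) - x (\<beta> k)))" by (intro sum_nonneg) auto
    finally show ?thesis .
  next
    case False
    define m where "m = Min (x ` A)"
    \<comment> \<open>Lowering \<open>A\<close> by its least value sends the minimiser
      \<open>a\<close> to \<open>0\<close>, so the number of positive entries decreases.\<close>
    define y where "y v = (if v \<in> A then x v - m else x v)" for v
    obtain a where a: "a \<in> A" "x a = m"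
      using Min_in[of "x ` A"] finA False unfolding m_def by fastforce
    have m_le: "m \<le> x v" if "v \<in> A" for v using that finA by (simp add: m_def)
    have m_pos: "m > 0" using a by (auto simp: A_def)
    have x0: "x v = 0" if "v \<in> V" "v \<notin> A" for v
      using that less.prems(1)[of v] by (auto simp: A_def)
    \<comment> \<open>Monotonicity along \<open>R\<close> makes the level set \<open>A\<close>
      closed, so \<open>cut\<close> applies to it.\<close>
    have up: "v \<in> A" if "(u, v) \<in> R" "u \<in> A" for u v
      using that less.prems(2)[of u v] R by (auto simp: A_def)
    have "{v \<in> V. y v > 0} \<subseteq> A - {a}"
    proof
      fix v assume v: "v \<in> {v \<in> V. y v > 0}"
      have "y a = 0" using a by (simp add: y_def)
      moreover have "v \<in> A"
        by (rule ccontr) (use v x0[of v] in \<open>simp add: y_def\<close>)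
      ultimately show "v \<in> A - {a}" using v by auto
    qed
    then have "card {v \<in> V. y v > 0} < card {v \<in> V. x v > 0}"
      using a finA unfolding A_def by (intro psubset_card_mono) auto
    moreover have "y v \<ge> 0" if "v \<in> V" for v
      using m_le less.prems(1) that by (auto simp: y_def)
    moreover have "y u \<le> y v" if "(u, v) \<in> R" for u v
      using up[OF that] less.prems(2)[OF that] x0[of u] R that m_le[of v]
      by (auto simp: y_def)
    ultimately have IH: "(\<Sum>v\<in>V. w v * y v) \<le> (\<Sum>k\<in>I. max 0 (y (\<alpha> k) - y (\<beta> k)))"
      by (rule less.hyps)
    have A_sub: "A \<subseteq> V" by (auto simp: A_def)
    have "(\<Sum>v\<in>V. w v * x v) = (\<Sum>v\<in>V. w v * y v + (if v \<in> A then m * w v else 0))"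
      by (intro sum.cong) (auto simp: y_def algebra_simps)
    also have "\<dots> = (\<Sum>v\<in>V. w v * y v) + m * sum w A"
      using fin A_sub by (simp add: sum.distrib sum_distrib_left sum.If_cases Int_absorb1)
    also have "\<dots> \<le> (\<Sum>k\<in>I. max 0 (y (\<alpha> k) - y (\<beta> k))) + m * card {k \<in> I. \<alpha> k \<in> A \<and> \<beta> k \<notin> A}"
      using IH m_pos cut[OF A_sub up] by (intro add_mono mult_left_mono) auto
    also have "\<dots> = (\<Sum>k\<in>I. max 0 (y (\<alpha> k) - y (\<beta> k)) +
        (if \<alpha> k \<in> A \<and> \<beta> k \<notin> A then m else 0))"
      using fin by (simp add: sum.distrib sum.If_cases Int_def mult.commute)
    also have "\<dots> = (\<Sum>k\<in>I. max 0 (x (\<alpha> k) - x (\<beta> k)))"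
    proof (intro sum.cong refl)
      \<comment> \<open>With both ends in \<open>A\<close> the shift by \<open>m\<close> cancels.
        Outside \<open>A\<close> the values are \<open>0\<close>, so a pair leaving \<open>A\<close>
        gains exactly \<open>m\<close>, and a pair entering \<open>A\<close> contributes
        \<open>0\<close> before and after.\<close>
      fix k assume "k \<in> I"
      then show "max 0 (y (\<alpha> k) - y (\<beta> k)) + (if \<alpha> k \<in> A \<and> \<beta> k \<notin> A then m else 0)
          = max 0 (x (\<alpha> k) - x (\<beta> k))"
        using ab[of k] x0[of "\<alpha> k"] x0[of "\<beta> k"] m_le[of "\<alpha> k"] m_le[of "\<beta> k"] m_pos
        by (auto simp: y_def max_def)
    qed
    finally show ?thesis .
  qed
qed

subsection \<open>Cyclic indices\<close>

lemma cyc_in: "d \<ge> 1 \<Longrightarrow> cyc d m \<in> {1..d}"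
  using mod_less_divisor[of d m] by (auto simp: cyc_def Suc_le_eq intro: less_imp_le)

lemma cyc_mod: "cyc d m mod d = m mod d"
  by (simp add: cyc_def)

lemma cyc_eq_iff: "cyc d m = cyc d n \<longleftrightarrow> m mod d = n mod d"
  by (metis cyc_def cyc_mod)

lemma cyc_id: "k \<in> {1..d} \<Longrightarrow> cyc d k = k"
  by (cases "k = d") (auto simp: cyc_def)

lemma cyc_add_cyc: "cyc d (cyc d m + n) = cyc d (m + n)"
  by (simp add: cyc_eq_iff mod_add_cong[OF cyc_mod refl])

lemma mod_add_right_cancel_nat:
  fixes x y m d :: nat
  assumes "(x + m) mod d = (y + m) mod d"
  shows "x mod d = y mod d"
  using assms
proof (induction x y rule: linorder_wlog)
  case (le x y)
  then show ?case using mod_eq_dvd_iff_nat[of "x + m" "y + m" d] mod_eq_dvd_iff_nat[of x y d] by simp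
qed simp

lemma cyc_shift_inj: "inj_on (\<lambda>k. cyc d (k + m)) {1..d}"
proof (rule inj_onI)
  fix x y assume xy: "x \<in> {1..d}" "y \<in> {1..d}" "cyc d (x + m) = cyc d (y + m)"
  then have "x mod d = y mod d"
    using mod_add_right_cancel_nat[of x m d y] by (simp add: cyc_eq_iff)
  then have "cyc d x = cyc d y" by (simp add: cyc_eq_iff)
  then show "x = y" using xy(1,2) by (simp add: cyc_id)
qed

lemma cyc_surj_shift:
  assumes "i \<in> {1..d}" "l \<le> d"
  obtains m where "m < d" "cyc d (l + m) = i"
proof -
  have "(l + (i + d - l) mod d) mod d = (l + (i + d - l)) mod d"
    by (simp add: mod_simps)
  also have "\<dots> = i mod d" using assms by simp
  finally have "cyc d (l + (i + d - l) mod d) = i"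
    using cyc_id[OF assms(1)] cyc_eq_iff by metis
  moreover have "(i + d - l) mod d < d" using assms by auto
  ultimately show thesis using that by blast
qed

text \<open>
  The right-hand sides count the maximal cyclic arcs of \<open>A\<close> by their last elements; the induction
  removes one maximal arc.
\<close>

lemma arc_sum_le_arc_count:
  fixes w :: "nat \<Rightarrow> real"
  assumes d: "d \<ge> 1"
    and arc: "\<And>l k. l \<in> {1..d} \<Longrightarrow> k + 2 \<le> d \<Longrightarrow> (\<Sum>m=0..k. w (cyc d (l + m))) < 1"
    and "A \<subset> {1..d}"
  shows "sum w A \<le> card {k \<in> A. cyc d (k + 1) \<notin> A} \<and>
    (A \<noteq> {} \<longrightarrow> sum w A < card {k \<in> A. cyc d (k + 1) \<notin> A})"
  using assms(3)
proof (induction "card A" arbitrary: A rule: less_induct)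
  case less
  have fin: "finite A" using less.prems finite_subset by blast
  show ?case
  proof (cases "A = {}")
    case False
    \<comment> \<open>Without such an entrance into \<open>A\<close> the complement would be closed
      under successors, and walking on from a point \<open>q\<close> outside \<open>A\<close> would
      exhaust the circle.\<close>
    have "\<exists>p. p \<in> {1..d} \<and> p \<notin> A \<and> cyc d (p + 1) \<in> A"
    proof (rule ccontr)
      assume none: "\<nexists>p. p \<in> {1..d} \<and> p \<notin> A \<and> cyc d (p + 1) \<in> A"
      have step: "cyc d (p + 1) \<notin> A" if "p \<in> {1..d}" "p \<notin> A" for p
        using none that by blast
      obtain q where q: "q \<in> {1..d}" "q \<notin> A" using less.prems by blast
      have "cyc d (q + m) \<notin> A" for m
      proof (induction m)
        case 0
        then show ?case using q by (simp add: cyc_id)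
      next
        case (Suc m)
        then show ?case using step[OF cyc_in[OF d] Suc] cyc_add_cyc[of d "q + m" 1] by simp
      qed
      moreover obtain i where "i \<in> A" using False by blast
      ultimately show False
        using less.prems cyc_surj_shift[of i d q] q by (metis atLeastAtMost_iff psubsetD)
    qed
    then obtain p where p: "p \<in> {1..d}" "p \<notin> A" "cyc d (p + 1) \<in> A" by blast
    define l where "l = cyc d (p + 1)"
    have l: "l \<in> {1..d}" "l \<in> A" using cyc_in[OF d] p by (simp_all add: l_def)
    \<comment> \<open>The length of the maximal arc of \<open>A\<close> starting at
      \<open>l\<close>. It is at most \<open>d - 1\<close>, because that many steps lead to
      \<open>p\<close>.\<close>
    define m0 where "m0 = (LEAST m. cyc d (l + m) \<notin> A)"
    have "cyc d (l + (d - 1)) = cyc d (p + 1 + (d - 1))"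
      unfolding l_def by (rule cyc_add_cyc)
    also have "\<dots> = cyc d p" using d by (simp add: cyc_eq_iff)
    also have "\<dots> = p" using p by (simp add: cyc_id)
    finally have last: "cyc d (l + (d - 1)) \<notin> A" using p by simp
    then have m0: "cyc d (l + m0) \<notin> A" "m0 \<le> d - 1"
      unfolding m0_def by (rule LeastI, rule Least_le)
    have below: "cyc d (l + m) \<in> A" if "m < m0" for m
      using that not_less_Least unfolding m0_def by blast
    have "m0 \<noteq> 0"
    proof
      assume "m0 = 0"
      then show False using m0(1) l by (simp add: cyc_id)
    qed
    then obtain k where k: "m0 = Suc k" using not0_implies_Suc by blast
    have kd: "k + 2 \<le> d" using m0(2) k d by simp
    define C where "C = (\<lambda>m. cyc d (l + m)) ` {0..k}"
    have C_sub: "C \<subseteq> A" using below k by (auto simp: C_def)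
    have inj: "inj_on (\<lambda>m. cyc d (l + m)) {0..k}"
    proof (rule inj_onI)
      fix x y assume xy: "x \<in> {0..k}" "y \<in> {0..k}" "cyc d (l + x) = cyc d (l + y)"
      then have "x mod d = y mod d"
        using mod_add_right_cancel_nat[of x l d y] by (simp add: cyc_eq_iff add.commute)
      then show "x = y" using xy kd by simp
    qed
    have sumC: "sum w C < 1"
      using arc[OF l(1) kd] by (simp add: C_def sum.reindex[OF inj])
    have "l \<in> C" using l by (auto simp: C_def cyc_id intro!: image_eqI[of _ _ 0])
    have "card (A - C) < card A"
      using C_sub \<open>l \<in> C\<close> fin by (intro psubset_card_mono) auto
    moreover have "A - C \<subset> {1..d}" using less.prems by blast
    ultimately have IH: "sum w (A - C) \<le> card {k \<in> A - C. cyc d (k + 1) \<notin> A - C}"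
      using less.hyps by blast
    \<comment> \<open>Ends of \<open>A - C\<close> are ends of \<open>A\<close>: a successor in
      \<open>C\<close> would force the point to be \<open>p\<close> or itself an element of
      \<open>C\<close>. The end of the removed arc comes in addition.\<close>
    have "insert (cyc d (l + k)) {k \<in> A - C. cyc d (k + 1) \<notin> A - C} \<subseteq> {k \<in> A. cyc d (k + 1) \<notin> A}"
    proof -
      have "cyc d (cyc d (l + k) + 1) \<notin> A" using m0 k cyc_add_cyc[of d "l + k" 1] by simp
      moreover have "cyc d (x + 1) \<notin> A" if x: "x \<in> A - C" "cyc d (x + 1) \<notin> A - C" for x
      proof
        assume "cyc d (x + 1) \<in> A"
        then obtain m where m: "m \<le> k" "cyc d (x + 1) = cyc d (l + m)"
          using x by (auto simp: C_def)
        have xd: "x \<in> {1..d}" using x less.prems by auto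
        show False
        proof (cases m)
          case 0
          then have "cyc d (x + 1) = cyc d (p + 1)"
            using m cyc_id[OF l(1)] unfolding l_def by simp
          then have "x = p" using inj_onD[OF cyc_shift_inj] xd p(1) by blast
          then show False using x p by simp
        next
          case (Suc m')
          then have "cyc d (x + 1) = cyc d (cyc d (l + m') + 1)"
            using m cyc_add_cyc[of d "l + m'" 1] by simp
          then have "x = cyc d (l + m')"
            using inj_onD[OF cyc_shift_inj _ xd cyc_in[OF d]] by blast
          then show False using x m Suc by (auto simp: C_def)
        qed
      qed
      ultimately show ?thesis using below k by auto
    qed
    then have "card (insert (cyc d (l + k)) {k \<in> A - C. cyc d (k + 1) \<notin> A - C})
        \<le> card {k \<in> A. cyc d (k + 1) \<notin> A}"
      using fin by (intro card_mono) auto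
    moreover have "cyc d (l + k) \<in> C" by (auto simp: C_def)
    ultimately have "card {k \<in> A - C. cyc d (k + 1) \<notin> A - C} + 1 \<le> card {k \<in> A. cyc d (k + 1) \<notin> A}"
      using fin by (subst (asm) card_insert_disjoint) auto
    moreover have "sum w A = sum w (A - C) + sum w C"
      using sum.subset_diff[OF C_sub fin] .
    ultimately show ?thesis using IH sumC by linarith
  qed auto
qed

subsection \<open>Absolute convergence\<close>

definition next_top :: "nat \<Rightarrow> (nat \<Rightarrow> nat) \<Rightarrow> nat \<Rightarrow> nat \<times> nat" where
  "next_top d r k = (cyc d (k + 1), r (cyc d (k + 1)))"

text \<open>If all blocks have length one, \<open>A\<close> is a union of cyclic arcs or the whole
  circle, where the total condition of \<open>W\<close> applies. Otherwise \<open>A\<close> meets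
  each block in a final segment, whose contribution is nonpositive by \<open>W\<close>; strictness
  comes from a block with \<open>r k \<noteq> 1\<close> that meets \<open>A\<close>, or from a link
  leaving \<open>A\<close>.\<close>

lemma cut_bound:
  assumes d: "d \<ge> 1" and r: "\<And>i. i \<in> {1..d} \<Longrightarrow> r i \<ge> 1" and s: "s \<in> W d r"
    and A: "A \<subseteq> idx d r" "A \<noteq> {}"
    and up: "\<And>k j. (k, j) \<in> A \<Longrightarrow> j < r k \<Longrightarrow> (k, j + 1) \<in> A"
  shows "(\<Sum>v\<in>A. 1 - Re (s v)) < card {k \<in> {1..d}. (k, 1) \<in> A \<and> next_top d r k \<notin> A}"
proof (cases "\<exists>i\<in>{1..d}. r i \<noteq> 1")
  case False
  then have r1: "r i = 1" if "i \<in> {1..d}" for i using that by blast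
  have W: "real d < Re (\<Sum>i=1..d. s (i, 1))"
    "\<And>l k. l \<in> {1..d} \<Longrightarrow> k + 2 \<le> d \<Longrightarrow> real k < Re (\<Sum>m=0..k. s (cyc d (l + m), 1))"
    using s False unfolding W_def by auto
  define B where "B = {k. (k, 1) \<in> A}"
  define w where "w k = 1 - Re (s (k, 1))" for k
  have B_sub: "B \<subseteq> {1..d}" using A by (auto simp: B_def idx_def)
  have AB: "A = (\<lambda>k. (k, 1)) ` B"
    using A r1 by (force simp: B_def idx_def image_iff)
  have sumA: "(\<Sum>v\<in>A. 1 - Re (s v)) = sum w B"
    by (simp add: AB sum.reindex inj_on_def w_def)
  have cut: "{k \<in> {1..d}. (k, 1) \<in> A \<and> next_top d r k \<notin> A} = {k \<in> B. cyc d (k + 1) \<notin> B}"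
    using B_sub r1[OF cyc_in[OF d]] by (auto simp: B_def next_top_def)
  show ?thesis
  proof (cases "B = {1..d}")
    case True
    then have "sum w B < 0" using W(1) by (simp add: w_def sum_subtractf)
    also have "0 \<le> real (card {k \<in> B. cyc d (k + 1) \<notin> B})" by simp
    finally show ?thesis unfolding sumA cut .
  next
    case False
    then have "B \<subset> {1..d}" "B \<noteq> {}" using B_sub A AB by auto
    moreover have "(\<Sum>m=0..k. w (cyc d (l + m))) < 1" if "l \<in> {1..d}" "k + 2 \<le> d" for l k
      using W(2)[OF that] by (simp add: w_def sum_subtractf)
    ultimately show ?thesis
      using arc_sum_le_arc_count[OF d] unfolding sumA cut by blast
  qed
next
  case True
  have W: "(\<forall>j\<in>{1..r i}. (\<Sum>l=j..r i. Re (s (i, l))) > real (r i + 1 - j))" if "i \<in> {1..d}" "r i \<noteq> 1" for i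
    using s True that unfolding W_def by auto
  have W1: "Re (s (i, 1)) \<ge> 1" if "i \<in> {1..d}" "r i = 1" for i
    using s True that unfolding W_def by auto
  define B where "B k = {j. (k, j) \<in> A}" for k
  define b where "b k = (\<Sum>j\<in>B k. 1 - Re (s (k, j)))" for k
  have B_sub: "B k \<subseteq> {1..r k}" for k using A by (auto simp: B_def idx_def)
  have B_fin: "finite (B k)" for k using B_sub finite_subset by blast
  have B_eq: "B k = {Min (B k)..r k}" if "B k \<noteq> {}" for k
  proof (intro equalityI subsetI)
    fix j assume "j \<in> B k"
    then show "j \<in> {Min (B k)..r k}" using B_sub[of k] B_fin by auto
  next
    fix j assume j: "j \<in> {Min (B k)..r k}"
    then have "Min (B k) \<le> j" by simp
    then have "j \<le> r k \<longrightarrow> j \<in> B k"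
    proof (induction rule: dec_induct)
      case base
      then show ?case using Min_in[OF B_fin that] by simp
    next
      case (step n)
      then show ?case using up[of k n] by (auto simp: B_def)
    qed
    then show "j \<in> B k" using j by simp
  qed
  have b_neg: "b k < 0" if "k \<in> {1..d}" "r k \<noteq> 1" "B k \<noteq> {}" for k
  proof -
    define m where "m = Min (B k)"
    have B: "B k = {m..r k}" using B_eq that by (simp add: m_def)
    have m: "m \<in> {1..r k}" using Min_in[OF B_fin that(3)] B_sub[of k] unfolding m_def by blast
    have "b k = real (r k + 1 - m) - (\<Sum>l=m..r k. Re (s (k, l)))"
      by (simp add: b_def B sum_subtractf)
    then show ?thesis using W[OF that(1,2)] m by auto
  qed
  have b_le: "b k \<le> 0" if "k \<in> {1..d}" for k
  proof (cases "B k = {} \<or> r k \<noteq> 1")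
    case True
    then show ?thesis
    proof (cases "B k = {}")
      case False
      then show ?thesis using True b_neg[OF that] by linarith
    qed (simp add: b_def)
  next
    case False
    then have "B k = {1}" using B_sub[of k] by auto
    then show ?thesis using W1[OF that] False by (simp add: b_def)
  qed
  have "A = (SIGMA k:{1..d}. B k)" using A by (auto simp: B_def idx_def)
  then have sumA: "(\<Sum>v\<in>A. 1 - Re (s v)) = (\<Sum>k=1..d. b k)"
    using B_fin by (simp add: b_def sum.Sigma case_prod_unfold)
  have sum_le: "(\<Sum>k=1..d. b k) \<le> 0" by (intro sum_nonpos b_le)
  show ?thesis
  proof (cases "\<exists>k\<in>{1..d}. r k \<noteq> 1 \<and> B k \<noteq> {}")
    case True
    then obtain k where "k \<in> {1..d}" "b k < 0" using b_neg by blast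
    then have "(\<Sum>k=1..d. b k) < (\<Sum>k=1..d. 0)"
      by (intro sum_strict_mono_ex1) (auto intro: b_le)
    then show ?thesis unfolding sumA by simp
  next
    case no_long: False
    obtain k0 where k0: "k0 \<in> {1..d}" "(k0, 1) \<in> A"
    proof -
      obtain k j where kj: "(k, j) \<in> A" using A by auto
      then have "k \<in> {1..d}" "j \<in> B k" using A by (auto simp: idx_def B_def)
      then have "r k = 1" using no_long by auto
      then show thesis using that B_sub[of k] kj \<open>j \<in> B k\<close> \<open>k \<in> {1..d}\<close> by auto
    qed
    \<comment> \<open>If no link left \<open>A\<close>, a walk from \<open>k0\<close> would put the
      first index of every block into \<open>A\<close>, including that of a block with
      \<open>r i \<noteq> 1\<close>.\<close>
    have "{k \<in> {1..d}. (k, 1) \<in> A \<and> next_top d r k \<notin> A} \<noteq> {}"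
    proof
      assume "{k \<in> {1..d}. (k, 1) \<in> A \<and> next_top d r k \<notin> A} = {}"
      then have step: "next_top d r k \<in> A" if "k \<in> {1..d}" "(k, 1) \<in> A" for k
        using that by blast
      have all: "(cyc d (k0 + m), 1) \<in> A" for m
      proof (induction m)
        case 0
        then show ?case using k0 by (simp add: cyc_id)
      next
        case (Suc m)
        have "next_top d r (cyc d (k0 + m)) \<in> A" using step[OF cyc_in[OF d] Suc] .
        then have *: "(cyc d (k0 + Suc m), r (cyc d (k0 + Suc m))) \<in> A"
          using cyc_add_cyc[of d "k0 + m" 1] by (simp add: next_top_def)
        then have "B (cyc d (k0 + Suc m)) \<noteq> {}" by (auto simp: B_def)
        then have "r (cyc d (k0 + Suc m)) = 1" using no_long cyc_in[OF d] by blast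
        then show ?case using * by simp
      qed
      obtain i where i: "i \<in> {1..d}" "r i \<noteq> 1" using True by blast
      obtain m where "cyc d (k0 + m) = i" using cyc_surj_shift[OF i(1), of k0] k0(1) by auto
      then have "(i, 1) \<in> A" using all by metis
      then show False using no_long i by (auto simp: B_def)
    qed
    then have "card {k \<in> {1..d}. (k, 1) \<in> A \<and> next_top d r k \<notin> A} > 0"
      by (subst card_gt_0_iff) auto
    then show ?thesis using sum_le unfolding sumA by linarith
  qed
qed

section \<open>Uniform slack and pointwise domination\<close>

lemma idx_finite [simp]: "finite (idx d r)"
  by (simp add: idx_def)

text \<open>There are only finitely many upward closed sets, so the strict inequalities of
  \<open>cut_bound\<close> have a common positive slack, which is spread over the indices.\<close>

lemma uniform_cut_bound:
  assumes d: "d \<ge> 1" and r: "\<And>i. i \<in> {1..d} \<Longrightarrow> r i \<ge> 1" and s: "s \<in> W d r"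
  shows "\<exists>\<eta>>0. \<forall>A\<subseteq>idx d r. (\<forall>k j. (k, j) \<in> A \<longrightarrow> j < r k \<longrightarrow> (k, j + 1) \<in> A) \<longrightarrow>
      (\<Sum>v\<in>A. 1 - Re (s v) + \<eta>) \<le> card {k \<in> {1..d}. (k, 1) \<in> A \<and> next_top d r k \<notin> A}"
proof -
  define U where "U = {A. A \<subseteq> idx d r \<and> A \<noteq> {} \<and> (\<forall>k j. (k, j) \<in> A \<longrightarrow> j < r k \<longrightarrow> (k, j + 1) \<in> A)}"
  define g where "g A = card {k \<in> {1..d}. (k, 1) \<in> A \<and> next_top d r k \<notin> A} - (\<Sum>v\<in>A. 1 - Re (s v))" for A
  \<comment> \<open>The element \<open>1\<close> guarantees a minimum over a nonempty set. Dividing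
    by more than the number of indices keeps the total loss on any \<open>A\<close> below
    \<open>\<delta>\<close>.\<close>
  define \<delta> where "\<delta> = Min (insert 1 (g ` U))"
  define \<eta> where "\<eta> = \<delta> / (card (idx d r) + 1)"
  have "finite U"
    by (rule finite_subset[of _ "Pow (idx d r)"]) (auto simp: U_def)
  have g_pos: "g A > 0" if "A \<in> U" for A
    using cut_bound[OF d r s, of A] that by (auto simp: U_def g_def)
  have \<delta>: "\<delta> > 0" using \<open>finite U\<close> g_pos by (auto simp: \<delta>_def)
  show ?thesis
  proof (intro exI[of _ \<eta>] conjI allI impI)
    show "\<eta> > 0" using \<delta> by (simp add: \<eta>_def)
    fix A assume A: "A \<subseteq> idx d r" "\<forall>k j. (k, j) \<in> A \<longrightarrow> j < r k \<longrightarrow> (k, j + 1) \<in> A"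
    show "(\<Sum>v\<in>A. 1 - Re (s v) + \<eta>) \<le> card {k \<in> {1..d}. (k, 1) \<in> A \<and> next_top d r k \<notin> A}"
    proof (cases "A = {}")
      case False
      then have "A \<in> U" using A by (auto simp: U_def)
      then have "\<delta> \<le> g A" using \<open>finite U\<close> by (simp add: \<delta>_def)
      have "real (card A) \<le> real (card (idx d r) + 1)"
        using card_mono[OF idx_finite A(1)] by simp
      then have "real (card A) * \<delta> \<le> real (card (idx d r) + 1) * \<delta>"
        using \<delta> by (intro mult_right_mono) auto
      then have "real (card A) * \<eta> \<le> \<delta>"
        by (simp add: \<eta>_def pos_divide_le_eq mult.commute)
      then show ?thesis
        using \<open>\<delta> \<le> g A\<close> by (simp add: g_def sum.distrib)
    qed simp
  qed
qed

text \<open>The link out of block \<open>i\<close> is left free: in the sums over this base its two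
  ends bound the variable \<open>n\<close> instead.\<close>

definition linked :: "nat \<Rightarrow> (nat \<Rightarrow> nat) \<Rightarrow> nat \<Rightarrow> (nat \<times> nat \<Rightarrow> nat) set" where
  "linked d r i =
    {ns \<in> increasing_tuples d r. \<forall>k\<in>{1..d}. k \<noteq> i \<longrightarrow> ns (k, 1) \<le> ns (next_top d r k)}"

lemma increasing_tuples_ge_1: "ns \<in> increasing_tuples d r \<Longrightarrow> v \<in> idx d r \<Longrightarrow> ns v \<ge> 1"
  by (auto simp: increasing_tuples_def PiE_iff)

lemma increasing_tuples_less_iff:
  assumes "ns \<in> increasing_tuples d r" "k \<in> {1..d}" "j \<in> {1..r k}" "j' \<in> {1..r k}"
  shows "ns (k, j) < ns (k, j') \<longleftrightarrow> j < j'"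
proof -
  have "strict_mono_on {1..r k} (\<lambda>j. ns (k, j))"
    using assms by (simp add: increasing_tuples_def)
  from strict_mono_on_less[OF this assms(3,4)] show ?thesis .
qed

lemma next_top_in_idx:
  assumes "d \<ge> 1" "\<And>i. i \<in> {1..d} \<Longrightarrow> r i \<ge> 1"
  shows "next_top d r k \<in> idx d r"
  using cyc_in[OF assms(1)] assms(2)[OF cyc_in[OF assms(1)]] by (auto simp: idx_def next_top_def)

text \<open>In logarithms this is \<open>weighted_sum_le_cut_sum\<close>: the imposed links
  contribute nothing on the right, and the free one contributes \<open>max 0 (ln a - ln b)\<close>,
  the negative logarithm of \<open>min 1 (b / a)\<close>.\<close>

lemma linked_weight_le:
  assumes d: "d \<ge> 1" and r: "\<And>i. i \<in> {1..d} \<Longrightarrow> r i \<ge> 1" and s: "s \<in> W d r"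
  obtains \<eta> where "\<eta> > 0"
    "\<And>i ns. i \<in> {1..d} \<Longrightarrow> ns \<in> linked d r i \<Longrightarrow>
      (\<Prod>v\<in>idx d r. real (ns v) powr - Re (s v)) * min 1 (real (ns (next_top d r i)) / real (ns (i, 1)))
        \<le> (\<Prod>v\<in>idx d r. real (ns v) powr (- 1 - \<eta>))"
proof -
  obtain \<eta> where \<eta>: "\<eta> > 0"
    and cut: "\<forall>A\<subseteq>idx d r. (\<forall>k j. (k, j) \<in> A \<longrightarrow> j < r k \<longrightarrow> (k, j + 1) \<in> A) \<longrightarrow>
      (\<Sum>v\<in>A. 1 - Re (s v) + \<eta>) \<le> card {k \<in> {1..d}. (k, 1) \<in> A \<and> next_top d r k \<notin> A}"
    using uniform_cut_bound[OF d r s] by blast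
  show thesis
  proof
    show "\<eta> > 0" by fact
    fix i ns assume i: "i \<in> {1..d}" and ns: "ns \<in> linked d r i"
    then have inc: "ns \<in> increasing_tuples d r" by (simp add: linked_def)
    define x where "x v = ln (real (ns v))" for v
    define a b where "a = real (ns (i, 1))" and "b = real (ns (next_top d r i))"
    have ge1: "real (ns v) \<ge> 1" if "v \<in> idx d r" for v
      using increasing_tuples_ge_1[OF inc that] by simp
    have bot: "(k, 1) \<in> idx d r" if "k \<in> {1..d}" for k using r[OF that] that by (auto simp: idx_def)
    have ntop: "next_top d r k \<in> idx d r" for k by (rule next_top_in_idx[OF d r])
    have ab: "a \<ge> 1" "b \<ge> 1" using ge1[OF bot[OF i]] ge1[OF ntop] by (simp_all add: a_def b_def)
    \<comment> \<open>Closed sets for \<open>R\<close> are those upward closed in each block, for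
      which \<open>\<eta>\<close> was chosen.\<close>
    define R where "R = {((k, j), (k, j + 1)) | k j. (k, j) \<in> idx d r \<and> j < r k}"
    have "(\<Sum>v\<in>idx d r. (1 - Re (s v) + \<eta>) * x v)
        \<le> (\<Sum>k\<in>{1..d}. max 0 (x (k, 1) - x (next_top d r k)))"
    proof (rule weighted_sum_le_cut_sum[where R = R])
      show "R \<subseteq> idx d r \<times> idx d r" by (auto simp: R_def idx_def)
      show "(k, 1) \<in> idx d r \<and> next_top d r k \<in> idx d r" if "k \<in> {1..d}" for k
        using bot[OF that] ntop by blast
      show "(\<Sum>v\<in>A. 1 - Re (s v) + \<eta>) \<le> card {k \<in> {1..d}. (k, 1) \<in> A \<and> next_top d r k \<notin> A}"
        if A: "A \<subseteq> idx d r" "\<And>u v. (u, v) \<in> R \<Longrightarrow> u \<in> A \<Longrightarrow> v \<in> A" for A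
      proof -
        have "(k, j + 1) \<in> A" if "(k, j) \<in> A" "j < r k" for k j
          using A(2)[of "(k, j)" "(k, j + 1)"] A(1) that by (auto simp: R_def)
        then show ?thesis using cut A(1) by blast
      qed
      show "x v \<ge> 0" if "v \<in> idx d r" for v using ge1[OF that] by (simp add: x_def)
      show "x u \<le> x v" if uv: "(u, v) \<in> R" for u v
      proof -
        obtain k j where kj: "u = (k, j)" "v = (k, j + 1)" "(k, j) \<in> idx d r" "j < r k"
          using uv by (auto simp: R_def)
        then have "ns u < ns v"
          using increasing_tuples_less_iff[OF inc, of k j "j + 1"] by (auto simp: idx_def)
        then show ?thesis
          using increasing_tuples_ge_1[OF inc, of u] kj by (simp add: x_def)
      qed
    qed auto
    also have "\<dots> = (\<Sum>k\<in>{1..d}. if k = i then max 0 (ln a - ln b) else 0)"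
    proof (intro sum.cong refl)
      fix k assume k: "k \<in> {1..d}"
      have "x (k, 1) \<le> x (next_top d r k)" if "k \<noteq> i"
        using ns k that ge1[OF bot[OF k]] by (auto simp: linked_def x_def)
      then show "max 0 (x (k, 1) - x (next_top d r k)) = (if k = i then max 0 (ln a - ln b) else 0)"
        by (auto simp: x_def a_def b_def)
    qed
    also have "\<dots> = max 0 (ln a - ln b)" using i by simp
    finally have le: "(\<Sum>v\<in>idx d r. (1 - Re (s v) + \<eta>) * x v) \<le> max 0 (ln a - ln b)" .
    have le': "(\<Sum>v\<in>idx d r. - Re (s v) * x v) + min 0 (ln b - ln a)
        \<le> (\<Sum>v\<in>idx d r. (- 1 - \<eta>) * x v)"
    proof -
      have "(\<Sum>v\<in>idx d r. (1 - Re (s v) + \<eta>) * x v)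
          = (\<Sum>v\<in>idx d r. - Re (s v) * x v) - (\<Sum>v\<in>idx d r. (- 1 - \<eta>) * x v)"
        unfolding sum_subtractf[symmetric] by (intro sum.cong) (auto simp: algebra_simps)
      then show ?thesis using le by linarith
    qed
    have exp_sum: "exp (\<Sum>v\<in>idx d r. c v * x v) = (\<Prod>v\<in>idx d r. real (ns v) powr c v)" for c
      unfolding exp_sum[OF idx_finite]
      by (intro prod.cong refl) (use ge1 in \<open>fastforce simp: powr_def x_def\<close>)
    have "min 1 (b / a) = exp (min 0 (ln b - ln a))"
      using ab by (auto simp: min_def exp_diff)
    then have "(\<Prod>v\<in>idx d r. real (ns v) powr - Re (s v)) * min 1 (b / a)
        = exp ((\<Sum>v\<in>idx d r. - Re (s v) * x v) + min 0 (ln b - ln a))"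
      unfolding exp_add exp_sum by simp
    also have "\<dots> \<le> exp (\<Sum>v\<in>idx d r. (- 1 - \<eta>) * x v)" using le' by simp
    also have "\<dots> = (\<Prod>v\<in>idx d r. real (ns v) powr (- 1 - \<eta>))" by (rule exp_sum)
    finally show "(\<Prod>v\<in>idx d r. real (ns v) powr - Re (s v)) *
        min 1 (real (ns (next_top d r i)) / real (ns (i, 1)))
        \<le> (\<Prod>v\<in>idx d r. real (ns v) powr (- 1 - \<eta>))"
      by (simp add: a_def b_def)
  qed
qed

text \<open>The sequence \<open>harm n - ln n\<close> decreases from \<open>1\<close>, and any
  positive power absorbs the logarithm.\<close>

lemma harm_le_powr:
  fixes \<epsilon> :: real
  assumes "n \<ge> 1" "\<epsilon> > 0"
  shows "1 + harm n \<le> (2 + 1 / \<epsilon>) * real n powr \<epsilon>"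
proof -
  obtain m where m: "n = Suc m" using assms by (cases n) auto
  have "harm (Suc m) - ln (Suc m) \<le> harm (Suc 0) - ln (Suc 0)"
    using decseqD[OF decseq_harm_diff_ln] by blast
  then have "1 + harm n \<le> 2 + ln (real n)" by (simp add: m harm_expand)
  also have "ln (real n) \<le> real n powr \<epsilon> / \<epsilon>"
    using assms by (intro ln_powr_bound) auto
  also have "2 \<le> 2 * real n powr \<epsilon>"
    using assms by (simp add: ge_one_powr_ge_zero)
  finally show ?thesis by (simp add: algebra_simps)
qed

text \<open>The factor \<open>1 + harm b\<close> from \<open>upper_gap_le\<close> costs half of
  \<open>\<eta>\<close>; the other half makes the product of one-variable series converge.\<close>

lemma summable_on_linked_upper_gap:
  assumes d: "d \<ge> 1" and r: "\<And>i. i \<in> {1..d} \<Longrightarrow> r i \<ge> 1" and s: "s \<in> W d r" and i: "i \<in> {1..d}"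
  shows "(\<lambda>ns. (\<Prod>v\<in>idx d r. real (ns v) powr - Re (s v)) * upper_gap (ns (i, 1)) (ns (next_top d r i)))
    summable_on linked d r i"
proof -
  obtain \<eta> where \<eta>: "\<eta> > 0"
    and weight: "\<And>ns. ns \<in> linked d r i \<Longrightarrow>
      (\<Prod>v\<in>idx d r. real (ns v) powr - Re (s v)) * min 1 (real (ns (next_top d r i)) / real (ns (i, 1)))
        \<le> (\<Prod>v\<in>idx d r. real (ns v) powr (- 1 - \<eta>))"
    by (rule linked_weight_le[OF d r s]) (use i in \<open>auto\<close>)
  define C where "C = 2 + 1 / (\<eta> / 2)"
  have C: "C > 0" using \<eta> by (simp add: C_def add_pos_pos)
  have "summable (\<lambda>n. real n powr (- 1 - \<eta> / 2))"
    using \<eta> by (subst summable_real_powr_iff) auto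
  then have "(\<lambda>n. real n powr (- 1 - \<eta> / 2)) summable_on UNIV"
    by (intro summable_nonneg_imp_summable_on) auto
  then have "(\<lambda>n. real n powr (- 1 - \<eta> / 2)) summable_on {1..}"
    by (rule summable_on_subset_banach) auto
  then have "(\<lambda>ns. \<Prod>v\<in>idx d r. real (ns v) powr (- 1 - \<eta> / 2)) summable_on (idx d r \<rightarrow>\<^sub>E {1..})"
    by (intro summable_on_prod_PiE) auto
  then have "(\<lambda>ns. \<Prod>v\<in>idx d r. real (ns v) powr (- 1 - \<eta> / 2)) summable_on linked d r i"
    by (rule summable_on_subset_banach) (auto simp: linked_def increasing_tuples_def)
  then have "(\<lambda>ns. C * (\<Prod>v\<in>idx d r. real (ns v) powr (- 1 - \<eta> / 2))) summable_on linked d r i"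
    by (rule summable_on_cmult_right)
  then show ?thesis
  proof (rule summable_on_comparison_test)
    fix ns assume ns: "ns \<in> linked d r i"
    then have inc: "ns \<in> increasing_tuples d r" by (simp add: linked_def)
    define a b where "a = ns (i, 1)" and "b = ns (next_top d r i)"
    define P where "P = (\<Prod>v\<in>idx d r. real (ns v) powr - Re (s v))"
    have P: "P \<ge> 0" unfolding P_def by (intro prod_nonneg) auto
    have ntop: "next_top d r i \<in> idx d r" by (rule next_top_in_idx[OF d r])
    have ge1: "ns v \<ge> 1" if "v \<in> idx d r" for v
      using increasing_tuples_ge_1[OF inc that] .
    have ab: "a \<ge> 1" "b \<ge> 1"
      using ge1[of "(i, 1)"] ge1[OF ntop] r[OF i] i by (auto simp: a_def b_def idx_def)
    \<comment> \<open>All entries are at least \<open>1\<close>, so completing the single power to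
      the product over all indices cannot decrease it.\<close>
    have b_le: "real b powr (\<eta> / 2) \<le> (\<Prod>v\<in>idx d r. real (ns v) powr (\<eta> / 2))"
    proof -
      have "(\<Prod>v\<in>{next_top d r i}. real (ns v) powr (\<eta> / 2)) \<le> (\<Prod>v\<in>idx d r. real (ns v) powr (\<eta> / 2))"
        using ge1 ntop \<eta> by (intro prod_mono2) (auto intro!: ge_one_powr_ge_zero)
      then show ?thesis by (simp add: b_def)
    qed
    have "P * upper_gap a b \<le> P * ((1 + harm b) * min 1 (real b / real a))"
      by (intro mult_left_mono upper_gap_le ab P)
    also have "\<dots> \<le> P * (C * real b powr (\<eta> / 2) * min 1 (real b / real a))"
      using \<eta> ab P unfolding C_def by (intro mult_left_mono mult_right_mono harm_le_powr) auto
    also have "\<dots> = C * real b powr (\<eta> / 2) * (P * min 1 (real b / real a))" by simp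
    also have "\<dots> \<le> C * (\<Prod>v\<in>idx d r. real (ns v) powr (\<eta> / 2)) * (\<Prod>v\<in>idx d r. real (ns v) powr (- 1 - \<eta>))"
      using C P weight[OF ns] b_le
      by (intro mult_mono mult_left_mono) (auto simp: P_def a_def b_def intro!: mult_nonneg_nonneg prod_nonneg)
    also have "\<dots> = C * (\<Prod>v\<in>idx d r. real (ns v) powr (- 1 - \<eta> / 2))"
    proof -
      have "\<eta> / 2 + (- 1 - \<eta>) = - 1 - \<eta> / 2" by simp
      then show ?thesis
        by (simp only: prod.distrib[symmetric] powr_add[symmetric] mult.assoc)
    qed
    finally show "P * upper_gap a b \<le> C * (\<Prod>v\<in>idx d r. real (ns v) powr (- 1 - \<eta> / 2))" .
    show "P * upper_gap a b \<ge> 0" by (intro mult_nonneg_nonneg P upper_gap_nonneg)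
  qed
qed

subsection \<open>The summation sets as fibrations over linked tuples\<close>

definition closed_tuples :: "nat \<Rightarrow> (nat \<Rightarrow> nat) \<Rightarrow> (nat \<times> nat \<Rightarrow> nat) set" where
  "closed_tuples d r =
    {ns \<in> increasing_tuples d r. \<forall>k\<in>{1..d}. ns (k, 1) \<le> ns (next_top d r k)}"

lemma closed_tuples_eq:
  "i \<in> {1..d} \<Longrightarrow> closed_tuples d r = {ns \<in> linked d r i. ns (i, 1) \<le> ns (next_top d r i)}"
  by (auto simp: closed_tuples_def linked_def)

lemma linked_le:
  "ns \<in> linked d r i \<Longrightarrow> k \<in> {1..d} \<Longrightarrow> k \<noteq> i \<Longrightarrow> ns (k, 1) \<le> ns (next_top d r k)"
  by (simp add: linked_def)

lemma closed_tuples_le: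
  "ns \<in> closed_tuples d r \<Longrightarrow> k \<in> {1..d} \<Longrightarrow> ns (k, 1) \<le> ns (next_top d r k)"
  by (simp add: closed_tuples_def)

lemma multi_power_eq: "multi_power d r ns s = (\<Prod>v\<in>idx d r. of_nat (ns v) powr s v)"
  unfolding multi_power_def idx_def
  by (subst prod.Sigma) (auto intro!: prod.cong)

section \<open>The weight and the change of one entry\<close>

lemma norm_inverse_multi_power:
  assumes "ns \<in> increasing_tuples d r"
  shows "norm (1 / multi_power d r ns s) = (\<Prod>v\<in>idx d r. real (ns v) powr - Re (s v))"
proof -
  have "norm (multi_power d r ns s) = (\<Prod>v\<in>idx d r. real (ns v) powr Re (s v))"
    unfolding multi_power_eq prod_norm[symmetric]
    by (intro prod.cong refl) (simp add: norm_powr_real_powr)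
  then show ?thesis
    by (simp add: norm_divide powr_minus inverse_eq_divide prod_dividef)
qed

text \<open>The identity behind exchanging \<open>n\<close> with \<open>ns v\<close>: only the
  factor at \<open>v\<close> differs. Nonzero entries permit the cancellation, since
  \<open>0 powr z = 0\<close>.\<close>

lemma multi_power_upd:
  assumes "v \<in> idx d r" "ns v \<noteq> 0" "n \<noteq> 0"
  shows "of_nat (ns v) powr s v / (multi_power d r ns s * of_nat n powr s v)
    = 1 / multi_power d r (ns(v := n)) s"
proof -
  define P where "P = (\<Prod>u\<in>idx d r - {v}. of_nat (ns u) powr s u)"
  have "multi_power d r ns s = of_nat (ns v) powr s v * P"
    unfolding multi_power_eq P_def using assms(1) by (subst prod.remove[of _ v]) auto
  moreover have "multi_power d r (ns(v := n)) s = of_nat n powr s v * P"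
    unfolding multi_power_eq P_def using assms(1)
    by (subst prod.remove[of _ v]) (auto intro!: prod.cong)
  ultimately show ?thesis using assms by simp
qed

lemma has_sum_gap_below:
  "((\<lambda>n. 1 / (real n - real a)) has_sum harm (b - a - 1)) {n. a < n \<and> n < b}"
proof -
  have "{n. a < n \<and> n < b} = {a<..<b}" by auto
  moreover have "(\<Sum>n\<in>{a<..<b}. 1 / (real n - real a)) = harm (b - a - 1)"
    unfolding harm_def inverse_eq_divide
    by (rule sum.reindex_bij_witness[of _ "\<lambda>k. a + k" "\<lambda>n. n - a"]) (auto simp: of_nat_diff)
  ultimately show ?thesis by (simp add: has_sum_finite_iff)
qed

text \<open>Agrees with \<open>has_sum_gap_below\<close> through the reflection sending
  \<open>n\<close> to \<open>a + b - n\<close>; this makes neighbouring positions cancel.\<close>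

lemma has_sum_gap_above:
  "((\<lambda>n. 1 / (real b - real n)) has_sum harm (b - a - 1)) {n. a < n \<and> n < b}"
proof -
  have "{n. a < n \<and> n < b} = {a<..<b}" by auto
  moreover have "(\<Sum>n\<in>{a<..<b}. 1 / (real b - real n)) = harm (b - a - 1)"
    unfolding harm_def inverse_eq_divide
    by (rule sum.reindex_bij_witness[of _ "\<lambda>k. b - k" "\<lambda>n. b - n"]) (auto simp: of_nat_diff)
  ultimately show ?thesis by (simp add: has_sum_finite_iff)
qed

lemma has_sum_harm_interval:
  assumes "1 \<le> a" "a \<le> b"
  shows "((\<lambda>n. 1 / real n) has_sum (harm b - harm (a - 1))) {n. a \<le> n \<and> n \<le> b}"
proof -
  have "{n. a \<le> n \<and> n \<le> b} = {a..b}" by auto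
  moreover have "harm b - harm (a - 1) = (\<Sum>j=1..b - (a - 1). 1 / real (a - 1 + j))"
    using harm_diff_eq_sum[of "b - (a - 1)" b] assms by simp
  moreover have "\<dots> = (\<Sum>n\<in>{a..b}. 1 / real n)"
    by (rule sum.reindex_bij_witness[of _ "\<lambda>n. n - (a - 1)" "\<lambda>j. a - 1 + j"]) (use assms in auto)
  ultimately show ?thesis by (simp add: has_sum_finite_iff)
qed

text \<open>Comparison with the two neighbours suffices, since the other entries of block
  \<open>i\<close> lie beyond these.\<close>

lemma increasing_tuples_upd:
  assumes ns: "ns \<in> increasing_tuples d r" and ij: "(i, j) \<in> idx d r" and "n \<ge> 1"
    and low: "j > 1 \<Longrightarrow> ns (i, j - 1) < n" and high: "j < r i \<Longrightarrow> n < ns (i, j + 1)"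
  shows "ns((i, j) := n) \<in> increasing_tuples d r"
proof -
  have "strict_mono_on {1..r k} (\<lambda>l. (ns((i, j) := n)) (k, l))" if k: "k \<in> {1..d}" for k
  proof (rule strict_mono_onI)
    fix a b assume ab: "a \<in> {1..r k}" "b \<in> {1..r k}" "a < b"
    have lt: "ns (k, x) < ns (k, y) \<longleftrightarrow> x < y" if "x \<in> {1..r k}" "y \<in> {1..r k}" for x y
      using increasing_tuples_less_iff[OF ns k that] .
    consider "k = i" "b = j" | "k = i" "a = j" "b \<noteq> j" | "(k, a) \<noteq> (i, j)" "(k, b) \<noteq> (i, j)"
      by blast
    then show "(ns((i, j) := n)) (k, a) < (ns((i, j) := n)) (k, b)"
    proof cases
      case 1
      have "j - 1 \<in> {1..r k}" "\<not> j - 1 < a" "j > 1" using 1 ab by auto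
      then have "ns (k, a) \<le> ns (k, j - 1)"
        using lt[of "j - 1" a] ab(1) by (simp add: not_less)
      also have "\<dots> < n" using low[OF \<open>j > 1\<close>] 1 by simp
      finally show ?thesis using 1 ab(3) by simp
    next
      case 2
      have "j + 1 \<in> {1..r k}" "\<not> b < j + 1" "j < r k" using 2 ab by auto
      then have "ns (k, j + 1) \<le> ns (k, b)"
        using lt[of b "j + 1"] ab(2) by (simp add: not_less)
      moreover have "n < ns (k, j + 1)" using high \<open>j < r k\<close> 2 by simp
      ultimately show ?thesis using 2 by simp
    next
      case 3
      then show ?thesis using lt[OF ab(1,2)] ab(3) by auto
    qed
  qed
  moreover have "ns((i, j) := n) \<in> idx d r \<rightarrow>\<^sub>E {1..}"
    using ns ij \<open>n \<ge> 1\<close> by (auto simp: increasing_tuples_def PiE_iff extensional_def)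
  ultimately show ?thesis by (simp add: increasing_tuples_def)
qed

section \<open>Links and summation sets\<close>

locale cyclic_blocks =
  fixes d :: nat and r :: "nat \<Rightarrow> nat"
  assumes d_pos: "d \<ge> 1" and r_pos: "\<And>i. i \<in> {1..d} \<Longrightarrow> r i \<ge> 1"
begin

lemma pred_in: "cyc d (i - 1) \<in> {1..d}"
  by (rule cyc_in[OF d_pos])

text \<open>The subtraction is exact because \<open>i \<ge> 1\<close>; for \<open>i = 1\<close> the
  value \<open>0\<close> is read as \<open>d\<close>.\<close>

lemma cyc_pred:
  assumes "i \<in> {1..d}"
  shows "cyc d (cyc d (i - 1) + 1) = i"
  using assms by (simp only: cyc_add_cyc) (simp add: cyc_id)

lemma next_top_pred:
  assumes "i \<in> {1..d}"
  shows "next_top d r (cyc d (i - 1)) = (i, r i)"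
  unfolding next_top_def cyc_pred[OF assms] ..

text \<open>Injectivity of the cyclic shift. Consequently a change in block \<open>i\<close> can
  affect the upper end of only one link, the one from its predecessor.\<close>

lemma fst_next_top_eq_iff:
  assumes "i \<in> {1..d}" "k \<in> {1..d}"
  shows "fst (next_top d r k) = i \<longleftrightarrow> k = cyc d (i - 1)"
proof
  assume "fst (next_top d r k) = i"
  then have "cyc d (k + 1) = cyc d (cyc d (i - 1) + 1)"
    using cyc_pred[OF assms(1)] by (simp add: next_top_def)
  then show "k = cyc d (i - 1)"
    using inj_onD[OF cyc_shift_inj _ assms(2) pred_in] by blast
qed (use next_top_pred[OF assms(1)] in simp)

lemma eq_pred_iff: "k \<in> {1..d} \<Longrightarrow> k mod d = (i - 1) mod d \<longleftrightarrow> k = cyc d (i - 1)"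
  using cyc_eq_iff[of d k "i - 1"] by (simp add: cyc_id)

lemma S_tilde_iff:
  assumes "i \<in> {1..d}"
  shows "(ns, n) \<in> S_tilde d r i j \<longleftrightarrow> ns \<in> linked d r (cyc d (i - 1)) \<and> n \<ge> 1 \<and>
    ns (cyc d (i - 1), 1) \<le> max (ns (i, r i)) n \<and> ns (i, j) < n \<and> (j < r i \<longrightarrow> n < ns (i, j + 1))"
  unfolding S_tilde_def linked_def next_top_def[symmetric] using eq_pred_iff[of _ i] by auto

lemma le_last:
  assumes "ns \<in> increasing_tuples d r" "i \<in> {1..d}" "j \<in> {1..r i}"
  shows "ns (i, j) \<le> ns (i, r i)"
  using increasing_tuples_less_iff[OF assms(1,2), of "r i" j] assms(3)
  by (auto simp: not_less[symmetric])

text \<open>Here \<open>n < ns (i, j + 1) \<le> ns (i, r i)\<close>, so the maximum in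
  \<open>S_tilde\<close> is \<open>ns (i, r i)\<close> and the relaxed link is an ordinary
  one.\<close>

lemma S_tilde_inner:
  assumes i: "i \<in> {1..d}" and j: "j \<in> {1..<r i}"
  shows "S_tilde d r i j = Sigma (closed_tuples d r) (\<lambda>ns. {n. ns (i, j) < n \<and> n < ns (i, j + 1)})"
proof -
  have "(ns, n) \<in> S_tilde d r i j \<longleftrightarrow>
      ns \<in> closed_tuples d r \<and> ns (i, j) < n \<and> n < ns (i, j + 1)" for ns n
  proof -
    have "n < ns (i, r i)" if "ns \<in> linked d r (cyc d (i - 1))" "n < ns (i, j + 1)"
      using le_last[of ns i "j + 1"] that i j by (auto simp: linked_def)
    then show ?thesis
      using j unfolding S_tilde_iff[OF i] closed_tuples_eq[OF pred_in[of i]] next_top_pred[OF i] by auto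
  qed
  then show ?thesis by auto
qed

text \<open>Here \<open>n\<close> exceeds \<open>ns (i, r i)\<close>, so the maximum is
  \<open>n\<close>, and the link into block \<open>i\<close> turns into a lower bound for
  \<open>n\<close>.\<close>

lemma S_tilde_last:
  assumes i: "i \<in> {1..d}"
  shows "S_tilde d r i (r i) = Sigma (linked d r (cyc d (i - 1)))
    (\<lambda>ns. {n. ns (cyc d (i - 1), 1) \<le> n \<and> ns (i, r i) < n})"
proof -
  have "(ns, n) \<in> S_tilde d r i (r i) \<longleftrightarrow>
      ns \<in> linked d r (cyc d (i - 1)) \<and> ns (cyc d (i - 1), 1) \<le> n \<and> ns (i, r i) < n" for ns n
    unfolding S_tilde_iff[OF i] by auto
  then show ?thesis by auto
qed

lemma S_cyc_eq:
  assumes i: "i \<in> {1..d}"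
  shows "S_cyc d r i = Sigma (closed_tuples d r) (\<lambda>ns. {n. ns (i, 1) \<le> n \<and> n \<le> ns (next_top d r i)})"
proof -
  have "n \<ge> 1" if "ns \<in> increasing_tuples d r" "ns (i, 1) \<le> n" for ns n
    using increasing_tuples_ge_1[OF that(1), of "(i, 1)"] that(2) i r_pos[OF i] by (auto simp: idx_def)
  then show ?thesis
    unfolding S_cyc_def closed_tuples_def next_top_def[symmetric] by auto
qed

section \<open>Exchange of \<open>n\<close> with one entry\<close>

definition swap :: "nat \<times> nat \<Rightarrow> (nat \<times> nat \<Rightarrow> nat) \<times> nat \<Rightarrow> (nat \<times> nat \<Rightarrow> nat) \<times> nat" where
  "swap v = (\<lambda>(ns, n). (ns(v := n), ns v))"

text \<open>This lets \<open>swap v\<close> serve as both directions of the bijections between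
  summation sets.\<close>

lemma swap_swap: "swap v (swap v x) = x"
  by (simp add: swap_def split: prod.split)

text \<open>The old first entry becomes the new \<open>n\<close> and takes along the bound from the
  link out of block \<open>i\<close>. The new first entry is not bound by it, so this link becomes
  the free one, while the link into block \<open>i\<close> is restored.\<close>

lemma swap_first_in:
  assumes i: "i \<in> {1..d}" and x: "x \<in> S_tilde d r i 1"
  shows "swap (i, 1) x \<in> Sigma (linked d r i) (\<lambda>ns. {n. 1 \<le> n \<and> n < ns (i, 1) \<and> n \<le> ns (next_top d r i)})"
proof -
  define p where "p = cyc d (i - 1)"
  obtain ns n where xn: "x = (ns, n)" by fastforce
  have S: "ns \<in> linked d r p" "n \<ge> 1" "ns (p, 1) \<le> max (ns (i, r i)) n" "ns (i, 1) < n"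
    "1 < r i \<Longrightarrow> n < ns (i, 1 + 1)"
    using x unfolding xn S_tilde_iff[OF i] p_def by auto
  have inc: "ns \<in> increasing_tuples d r" using S by (simp add: linked_def)
  have i1: "(i, 1) \<in> idx d r" using i r_pos[OF i] by (auto simp: idx_def)
  define ns' where "ns' = ns((i, 1) := n)"
  have inc': "ns' \<in> increasing_tuples d r"
    unfolding ns'_def by (rule increasing_tuples_upd[OF inc i1 S(2)]) (use S in auto)
  \<comment> \<open>The maximum in \<open>S_tilde\<close> is the last entry after the exchange: the
    new entry if \<open>r i = 1\<close>, the unchanged one otherwise.\<close>
  have p_le: "ns (p, 1) \<le> ns' (i, r i)"
  proof (cases "r i = 1")
    case True
    then show ?thesis using S by (simp add: ns'_def)
  next
    case False
    then have "1 < r i" using r_pos[OF i] by simp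
    then have "n < ns (i, r i)"
      using S(5) le_last[OF inc i, of "1 + 1"] by simp
    then show ?thesis using S(3) False by (simp add: ns'_def)
  qed
  have "ns' (k, 1) \<le> ns' (next_top d r k)" if k: "k \<in> {1..d}" "k \<noteq> i" for k
  proof (cases "k = p")
    case True
    then show ?thesis using p_le next_top_pred[OF i] k by (simp add: ns'_def p_def)
  next
    case False
    then have "fst (next_top d r k) \<noteq> i" using fst_next_top_eq_iff[OF i k(1)] by (simp add: p_def)
    then have "ns' (next_top d r k) = ns (next_top d r k)" by (auto simp: ns'_def)
    then show ?thesis using S(1) False k by (simp add: ns'_def linked_def)
  qed
  then have "ns' \<in> linked d r i" using inc' by (simp add: linked_def)
  moreover have "ns (i, 1) \<le> ns' (next_top d r i)"
  proof (cases "i = p")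
    \<comment> \<open>This is \<open>d = 1\<close>: the block is its own successor, and the bound
      comes from the order inside the updated block.\<close>
    case True
    have "ns' (i, 1) \<le> ns' (i, r i)" using le_last[OF inc' i, of 1] r_pos[OF i] by simp
    moreover have "next_top d r i = (i, r i)"
      using next_top_pred[OF i] True unfolding p_def by metis
    ultimately show ?thesis using S(4) by (simp add: ns'_def)
  next
    case False
    then have "fst (next_top d r i) \<noteq> i" using fst_next_top_eq_iff[OF i i] by (simp add: p_def)
    then have "ns' (next_top d r i) = ns (next_top d r i)" by (auto simp: ns'_def)
    then show ?thesis using S(1) False i by (simp add: linked_def)
  qed
  moreover have "1 \<le> ns (i, 1)" using increasing_tuples_ge_1[OF inc i1] .
  ultimately show ?thesis using S(4) by (simp add: xn swap_def ns'_def)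
qed

lemma swap_first_in':
  assumes i: "i \<in> {1..d}"
    and x: "x \<in> Sigma (linked d r i) (\<lambda>ns. {n. 1 \<le> n \<and> n < ns (i, 1) \<and> n \<le> ns (next_top d r i)})"
  shows "swap (i, 1) x \<in> S_tilde d r i 1"
proof -
  define p where "p = cyc d (i - 1)"
  obtain ns n where xn: "x = (ns, n)" by fastforce
  have S: "ns \<in> linked d r i" "n \<ge> 1" "n < ns (i, 1)" "n \<le> ns (next_top d r i)"
    using x by (auto simp: xn)
  have inc: "ns \<in> increasing_tuples d r" using S by (simp add: linked_def)
  have i1: "(i, 1) \<in> idx d r" using i r_pos[OF i] by (auto simp: idx_def)
  have second: "ns (i, 1) < ns (i, 1 + 1)" if "1 < r i"
    using increasing_tuples_less_iff[OF inc i, of 1 "1 + 1"] that by simp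
  define ns' where "ns' = ns((i, 1) := n)"
  have inc': "ns' \<in> increasing_tuples d r"
    unfolding ns'_def by (rule increasing_tuples_upd[OF inc i1 S(2)]) (use S(3) second in auto)
  have "ns' (k, 1) \<le> ns' (next_top d r k)" if k: "k \<in> {1..d}" "k \<noteq> p" for k
  proof -
    have "fst (next_top d r k) \<noteq> i" using fst_next_top_eq_iff[OF i k(1)] k by (simp add: p_def)
    then have "ns' (next_top d r k) = ns (next_top d r k)" by (auto simp: ns'_def)
    then show ?thesis using S(1,4) k by (simp add: ns'_def linked_def)
  qed
  then have "ns' \<in> linked d r p" using inc' by (simp add: linked_def)
  moreover have "ns' (p, 1) \<le> max (ns' (i, r i)) (ns (i, 1))"
  proof (cases "p = i")
    case True
    then show ?thesis using S(3) by (simp add: ns'_def)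
  next
    case False
    then have "ns (p, 1) \<le> ns (i, r i)"
      using linked_le[OF S(1) pred_in[of i]] unfolding next_top_pred[OF i] p_def by blast
    then show ?thesis using False by (auto simp: ns'_def)
  qed
  ultimately show ?thesis
    using S(3) second increasing_tuples_ge_1[OF inc i1]
    unfolding xn swap_def prod.case S_tilde_iff[OF i] by (simp add: ns'_def p_def)
qed

text \<open>For \<open>j > 1\<close> the first entry of block \<open>i\<close> is untouched, and the
  maximum in \<open>S_tilde\<close> becomes the last entry of the new tuple; hence all links hold
  afterwards.\<close>

lemma swap_later_in:
  assumes i: "i \<in> {1..d}" and j: "j \<in> {1<..r i}" and x: "x \<in> S_tilde d r i j"
  shows "swap (i, j) x \<in> Sigma (closed_tuples d r) (\<lambda>ns. {n. ns (i, j - 1) < n \<and> n < ns (i, j)})"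
proof -
  define p where "p = cyc d (i - 1)"
  obtain ns n where xn: "x = (ns, n)" by fastforce
  have S: "ns \<in> linked d r p" "n \<ge> 1" "ns (p, 1) \<le> max (ns (i, r i)) n" "ns (i, j) < n"
    "j < r i \<Longrightarrow> n < ns (i, j + 1)"
    using x unfolding xn S_tilde_iff[OF i] p_def by auto
  have inc: "ns \<in> increasing_tuples d r" using S by (simp add: linked_def)
  have ij: "(i, j) \<in> idx d r" using i j by (auto simp: idx_def)
  have before: "ns (i, j - 1) < ns (i, j)"
  proof -
    have "j - 1 \<in> {1..r i}" "j \<in> {1..r i}" "j - 1 < j" using j by auto
    then show ?thesis using increasing_tuples_less_iff[OF inc i] by blast
  qed
  define ns' where "ns' = ns((i, j) := n)"
  have inc': "ns' \<in> increasing_tuples d r"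
    unfolding ns'_def by (rule increasing_tuples_upd[OF inc ij S(2)]) (use S before in auto)
  have p_le: "ns (p, 1) \<le> ns' (i, r i)"
  proof (cases "j = r i")
    case True
    then show ?thesis using S by (simp add: ns'_def)
  next
    case False
    then have "j < r i" using j by simp
    then have "n < ns (i, r i)"
      using S(5) le_last[OF inc i, of "j + 1"] by simp
    then show ?thesis using S(3) False by (simp add: ns'_def)
  qed
  have "ns' (k, 1) \<le> ns' (next_top d r k)" if k: "k \<in> {1..d}" for k
  proof (cases "k = p")
    case True
    then show ?thesis using p_le next_top_pred[OF i] j by (simp add: ns'_def p_def)
  next
    case False
    then have "fst (next_top d r k) \<noteq> i" using fst_next_top_eq_iff[OF i k(1)] by (simp add: p_def)
    then have "ns' (next_top d r k) = ns (next_top d r k)" by (auto simp: ns'_def)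
    then show ?thesis using S(1) False k j by (simp add: ns'_def linked_def)
  qed
  then have "ns' \<in> closed_tuples d r" using inc' by (simp add: closed_tuples_def)
  moreover have "j - 1 \<noteq> j" using j by auto
  ultimately show ?thesis using S(4) before by (simp add: xn swap_def ns'_def)
qed

lemma swap_later_in':
  assumes i: "i \<in> {1..d}" and j: "j \<in> {1<..r i}"
    and x: "x \<in> Sigma (closed_tuples d r) (\<lambda>ns. {n. ns (i, j - 1) < n \<and> n < ns (i, j)})"
  shows "swap (i, j) x \<in> S_tilde d r i j"
proof -
  define p where "p = cyc d (i - 1)"
  obtain ns n where xn: "x = (ns, n)" by fastforce
  have S: "ns \<in> closed_tuples d r" "ns (i, j - 1) < n" "n < ns (i, j)"
    using x by (auto simp: xn)
  have inc: "ns \<in> increasing_tuples d r" using S by (simp add: closed_tuples_def)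
  have ij: "(i, j) \<in> idx d r" using i j by (auto simp: idx_def)
  have after: "ns (i, j) < ns (i, j + 1)" if "j < r i"
    using increasing_tuples_less_iff[OF inc i, of j "j + 1"] that j by simp
  define ns' where "ns' = ns((i, j) := n)"
  have inc': "ns' \<in> increasing_tuples d r"
    unfolding ns'_def by (rule increasing_tuples_upd[OF inc ij]) (use S(2,3) after in auto)
  have "ns' (k, 1) \<le> ns' (next_top d r k)" if k: "k \<in> {1..d}" "k \<noteq> p" for k
  proof -
    have "fst (next_top d r k) \<noteq> i" using fst_next_top_eq_iff[OF i k(1)] k by (simp add: p_def)
    then have "ns' (next_top d r k) = ns (next_top d r k)" by (auto simp: ns'_def)
    then show ?thesis using S(1) k j by (simp add: ns'_def closed_tuples_def)
  qed
  then have "ns' \<in> linked d r p" using inc' by (simp add: linked_def)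
  moreover have "ns' (p, 1) \<le> max (ns' (i, r i)) (ns (i, j))"
  proof -
    have "ns (p, 1) \<le> ns (i, r i)"
      using closed_tuples_le[OF S(1) pred_in[of i]] unfolding next_top_pred[OF i] p_def .
    then show ?thesis using j by (auto simp: ns'_def)
  qed
  ultimately show ?thesis
    using S(3) after increasing_tuples_ge_1[OF inc ij]
    unfolding xn swap_def prod.case S_tilde_iff[OF i] by (simp add: ns'_def p_def)
qed

end

lemma has_sum_diff:
  fixes f g :: "'a \<Rightarrow> 'b :: topological_ab_group_add"
  assumes "(f has_sum a) A" "(g has_sum b) A"
  shows "((\<lambda>x. f x - g x) has_sum (a - b)) A"
  using has_sum_add[OF assms(1), of "\<lambda>x. - g x" "- b"] assms(2) by (simp add: has_sum_uminus)

subsection \<open>Evaluation of the sums\<close>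

locale cyclic_sum = cyclic_blocks +
  fixes s :: "nat \<times> nat \<Rightarrow> complex"
  assumes s_in_W: "s \<in> W d r"
begin

definition weight :: "(nat \<times> nat \<Rightarrow> nat) \<Rightarrow> complex" where
  "weight ns = 1 / multi_power d r ns s"

text \<open>Every kernel that occurs is dominated by \<open>upper_gap\<close>, so this bound
  supplies the summability for each use of \<open>has_sum_Sigma_weighted\<close>.\<close>

lemma summable_on_linked:
  assumes i: "i \<in> {1..d}" and T: "T \<subseteq> linked d r i"
    and h: "\<And>ns. ns \<in> T \<Longrightarrow> 0 \<le> h ns \<and> h ns \<le> upper_gap (ns (i, 1)) (ns (next_top d r i))"
  shows "(\<lambda>ns. norm (weight ns) * h ns) summable_on T"
proof (rule summable_on_comparison_test)
  show "(\<lambda>ns. (\<Prod>v\<in>idx d r. real (ns v) powr - Re (s v)) * upper_gap (ns (i, 1)) (ns (next_top d r i)))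
      summable_on T"
    using summable_on_linked_upper_gap[OF d_pos r_pos s_in_W i] T by (rule summable_on_subset_banach)
  fix ns assume ns: "ns \<in> T"
  then have "norm (weight ns) = (\<Prod>v\<in>idx d r. real (ns v) powr - Re (s v))"
    using T unfolding weight_def by (intro norm_inverse_multi_power) (auto simp: linked_def)
  then show "norm (weight ns) * h ns
      \<le> (\<Prod>v\<in>idx d r. real (ns v) powr - Re (s v)) * upper_gap (ns (i, 1)) (ns (next_top d r i))"
    using h[OF ns] by (auto intro!: mult_left_mono prod_nonneg)
  show "0 \<le> norm (weight ns) * h ns" using h[OF ns] by simp
qed

definition upper_sum :: "nat \<Rightarrow> complex" where
  "upper_sum i = (\<Sum>\<^sub>\<infinity>ns\<in>linked d r i. weight ns * of_real (upper_gap (ns (i, 1)) (ns (next_top d r i))))"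

definition lower_sum :: "nat \<Rightarrow> complex" where
  "lower_sum i = (\<Sum>\<^sub>\<infinity>ns\<in>linked d r i. weight ns * of_real (lower_gap (ns (i, 1)) (ns (next_top d r i))))"

definition inner_sum :: "nat \<Rightarrow> nat \<Rightarrow> complex" where
  "inner_sum i j = (\<Sum>\<^sub>\<infinity>ns\<in>closed_tuples d r. weight ns * of_real (harm (ns (i, j + 1) - ns (i, j) - 1)))"

lemma closed_subset_linked: "closed_tuples d r \<subseteq> linked d r i"
  by (auto simp: closed_tuples_def linked_def)

text \<open>The distance of neighbours is at most the last entry of the block, whose harmonic number
  equals \<open>upper_gap\<close> for the link into block \<open>i\<close>, because that link holds
  for closed tuples.\<close>

lemma summable_inner:
  assumes i: "i \<in> {1..d}" and j: "j \<in> {1..<r i}"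
  shows "(\<lambda>ns. norm (weight ns) * harm (ns (i, j + 1) - ns (i, j) - 1)) summable_on closed_tuples d r"
proof (rule summable_on_linked[OF pred_in[of i] closed_subset_linked])
  fix ns assume ns: "ns \<in> closed_tuples d r"
  then have inc: "ns \<in> increasing_tuples d r" by (simp add: closed_tuples_def)
  have "ns (i, j + 1) \<le> ns (i, r i)" using le_last[OF inc i, of "j + 1"] j by simp
  then have "harm (ns (i, j + 1) - ns (i, j) - 1) \<le> (harm (ns (i, r i)) :: real)"
    by (intro harm_mono) simp
  moreover have "ns (cyc d (i - 1), 1) \<le> ns (i, r i)"
    using closed_tuples_le[OF ns pred_in[of i]] unfolding next_top_pred[OF i] .
  ultimately show "0 \<le> (harm (ns (i, j + 1) - ns (i, j) - 1) :: real) \<and>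
      harm (ns (i, j + 1) - ns (i, j) - 1) \<le> upper_gap (ns (cyc d (i - 1), 1)) (ns (next_top d r (cyc d (i - 1))))"
    unfolding next_top_pred[OF i] by (simp add: upper_gap_eq_harm harm_nonneg)
qed

section \<open>The two fractions of a summand\<close>

definition first_part :: "nat \<Rightarrow> nat \<Rightarrow> (nat \<times> nat \<Rightarrow> nat) \<times> nat \<Rightarrow> complex" where
  "first_part i j = (\<lambda>(ns, n). of_nat (ns (i, r i)) ^ (of_bool (j = r i) :: nat) /
       (multi_power d r ns s * of_nat n ^ (of_bool (j = r i) :: nat) * (of_nat n - of_nat (ns (i, j)))))"

definition second_part :: "nat \<Rightarrow> nat \<Rightarrow> (nat \<times> nat \<Rightarrow> nat) \<times> nat \<Rightarrow> complex" where
  "second_part i j = (\<lambda>(ns, n). of_nat (ns (i, j)) powr s (i, j) /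
       (multi_power d r ns s * of_nat n powr s (i, j) * (of_nat n - of_nat (ns (i, j)))))"

lemma zeta_tilde_term_eq: "zeta_tilde_term d r s i j = (\<lambda>x. first_part i j x - second_part i j x)"
  by (auto simp: zeta_tilde_term_def first_part_def second_part_def fun_eq_iff)

lemma has_sum_first_part_inner:
  assumes i: "i \<in> {1..d}" and j: "j \<in> {1..<r i}"
  shows "(first_part i j has_sum inner_sum i j) (S_tilde d r i j)"
proof -
  have "((\<lambda>(ns, n). weight ns * of_real (1 / (real n - real (ns (i, j))))) has_sum inner_sum i j)
      (S_tilde d r i j)"
    unfolding S_tilde_inner[OF i j] inner_sum_def
    by (rule has_sum_Sigma_weighted[OF has_sum_gap_below _ summable_inner[OF i j]]) auto
  moreover have "(\<lambda>(ns, n). weight ns * of_real (1 / (real n - real (ns (i, j))))) = first_part i j"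
    using j by (auto simp: first_part_def weight_def fun_eq_iff)
  ultimately show ?thesis by simp
qed

lemma has_sum_first_part_last:
  assumes i: "i \<in> {1..d}"
  shows "(first_part i (r i) has_sum upper_sum (cyc d (i - 1))) (S_tilde d r i (r i))"
proof -
  define p where "p = cyc d (i - 1)"
  have p: "p \<in> {1..d}" unfolding p_def by (rule pred_in)
  have next_p: "next_top d r p = (i, r i)" unfolding p_def by (rule next_top_pred[OF i])
  have "((\<lambda>(ns, n). weight ns * of_real (real (ns (i, r i)) / (real n * (real n - real (ns (i, r i))))))
      has_sum upper_sum p) (S_tilde d r i (r i))"
    unfolding S_tilde_last[OF i] upper_sum_def p_def[symmetric] next_p
  proof (rule has_sum_Sigma_weighted)
    fix ns assume ns: "ns \<in> linked d r p"
    then have "ns (i, r i) \<ge> 1"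
      using increasing_tuples_ge_1[of ns d r "(i, r i)"] i r_pos[OF i] by (auto simp: linked_def idx_def)
    then show "((\<lambda>n. real (ns (i, r i)) / (real n * (real n - real (ns (i, r i))))) has_sum
        upper_gap (ns (p, 1)) (ns (i, r i))) {n. ns (p, 1) \<le> n \<and> ns (i, r i) < n}"
      by (rule has_sum_upper_gap)
  next
    show "(\<lambda>ns. norm (weight ns) * upper_gap (ns (p, 1)) (ns (i, r i))) summable_on linked d r p"
      by (rule summable_on_linked[OF p]) (auto simp: next_p upper_gap_nonneg)
  qed auto
  moreover have "(\<lambda>(ns, n). weight ns * of_real (real (ns (i, r i)) / (real n * (real n - real (ns (i, r i))))))
      = first_part i (r i)"
    by (auto simp: first_part_def weight_def fun_eq_iff mult.assoc)
  ultimately show ?thesis by (simp add: p_def)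
qed

lemma second_part_swap:
  assumes i: "i \<in> {1..d}" and j: "j \<in> {1..r i}" and x: "x \<in> S_tilde d r i j"
  shows "(\<lambda>(ns, n). weight ns * of_real (1 / (real (ns (i, j)) - real n))) (swap (i, j) x)
    = second_part i j x"
proof -
  obtain ns n where xn: "x = (ns, n)" by fastforce
  have ns: "ns \<in> increasing_tuples d r" "n \<ge> 1"
    using x unfolding xn S_tilde_iff[OF i] by (auto simp: linked_def)
  have ij: "(i, j) \<in> idx d r" using i j by (auto simp: idx_def)
  have "ns (i, j) \<noteq> 0" using increasing_tuples_ge_1[OF ns(1) ij] by simp
  then show ?thesis
    using multi_power_upd[OF ij, of ns n s] ns(2)
    by (simp add: xn swap_def second_part_def weight_def flip: divide_divide_eq_left)
qed

lemma has_sum_second_part_first: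
  assumes i: "i \<in> {1..d}"
  shows "(second_part i 1 has_sum lower_sum i) (S_tilde d r i 1)"
proof -
  define N where "N ns = {n. 1 \<le> n \<and> n < ns (i, 1) \<and> n \<le> ns (next_top d r i)}"
    for ns :: "nat \<times> nat \<Rightarrow> nat"
  have j: "1 \<in> {1..r i}" using r_pos[OF i] by simp
  have "(second_part i 1 has_sum lower_sum i) (S_tilde d r i 1) \<longleftrightarrow>
    ((\<lambda>(ns, n). weight ns * of_real (1 / (real (ns (i, 1)) - real n))) has_sum lower_sum i)
      (Sigma (linked d r i) N)"
    unfolding N_def
    by (rule has_sum_reindex_bij_witness[where i = "swap (i, 1)" and j = "swap (i, 1)"])
       (simp_all only: swap_swap swap_first_in[OF i] swap_first_in'[OF i] second_part_swap[OF i j])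
  also have \<dots>
    unfolding lower_sum_def
  proof (rule has_sum_Sigma_weighted)
    show "((\<lambda>n. 1 / (real (ns (i, 1)) - real n)) has_sum
        lower_gap (ns (i, 1)) (ns (next_top d r i))) (N ns)" for ns
      unfolding N_def by (rule has_sum_lower_gap)
    show "(\<lambda>ns. norm (weight ns) * lower_gap (ns (i, 1)) (ns (next_top d r i))) summable_on linked d r i"
      by (rule summable_on_linked[OF i]) (auto simp: lower_gap_nonneg lower_gap_le_upper_gap)
  qed (auto simp: N_def)
  finally show ?thesis .
qed

lemma has_sum_second_part_later:
  assumes i: "i \<in> {1..d}" and j: "j \<in> {1<..r i}"
  shows "(second_part i j has_sum inner_sum i (j - 1)) (S_tilde d r i j)"
proof -
  define N where "N ns = {n. ns (i, j - 1) < n \<and> n < ns (i, j)}" for ns :: "nat \<times> nat \<Rightarrow> nat"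
  have j': "j \<in> {1..r i}" "j - 1 \<in> {1..<r i}" "j - 1 + 1 = j" using j by auto
  have "(second_part i j has_sum inner_sum i (j - 1)) (S_tilde d r i j) \<longleftrightarrow>
    ((\<lambda>(ns, n). weight ns * of_real (1 / (real (ns (i, j)) - real n))) has_sum inner_sum i (j - 1))
      (Sigma (closed_tuples d r) N)"
    unfolding N_def
    by (rule has_sum_reindex_bij_witness[where i = "swap (i, j)" and j = "swap (i, j)"])
       (simp_all only: swap_swap swap_later_in[OF i j] swap_later_in'[OF i j] second_part_swap[OF i j'(1)])
  also have \<dots>
    unfolding inner_sum_def j'(3)
  proof (rule has_sum_Sigma_weighted)
    show "((\<lambda>n. 1 / (real (ns (i, j)) - real n)) has_sum
        harm (ns (i, j) - ns (i, j - 1) - 1)) (N ns)" for ns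
      unfolding N_def by (rule has_sum_gap_above)
    show "(\<lambda>ns. norm (weight ns) * harm (ns (i, j) - ns (i, j - 1) - 1)) summable_on closed_tuples d r"
      using summable_inner[OF i j'(2)] unfolding j'(3) .
  qed (auto simp: N_def)
  finally show ?thesis .
qed

section \<open>Telescoping and assembly\<close>

lemma has_sum_zeta_tilde_term:
  assumes i: "i \<in> {1..d}" and j: "j \<in> {1..r i}"
  shows "(zeta_tilde_term d r s i j has_sum
    (if j = r i then upper_sum (cyc d (i - 1)) else inner_sum i j)
    - (if j = 1 then lower_sum i else inner_sum i (j - 1))) (S_tilde d r i j)"
  unfolding zeta_tilde_term_eq
proof (rule has_sum_diff)
  show "(first_part i j has_sum (if j = r i then upper_sum (cyc d (i - 1)) else inner_sum i j))
      (S_tilde d r i j)"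
    using has_sum_first_part_last[OF i] has_sum_first_part_inner[OF i, of j] j by auto
  show "(second_part i j has_sum (if j = 1 then lower_sum i else inner_sum i (j - 1))) (S_tilde d r i j)"
    using has_sum_second_part_first[OF i] has_sum_second_part_later[OF i, of j] j by auto
qed

lemma sum_zeta_tilde:
  assumes i: "i \<in> {1..d}"
  shows "(\<Sum>j=1..r i. zeta_tilde d r s i j) = upper_sum (cyc d (i - 1)) - lower_sum i"
proof -
  \<comment> \<open>The two sums share \<open>X 1\<close> to \<open>X m\<close>; for
    \<open>m = 0\<close> only the boundary values \<open>U\<close> and \<open>L\<close>
    occur.\<close>
  have tele: "(\<Sum>j=1..Suc m. (if j = Suc m then U else X j) - (if j = 1 then L else X (j - 1))) = U - L"
    for m and U L :: complex and X
  proof -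
    have "(\<Sum>j=1..Suc m. (if j = Suc m then U else X j)) = (\<Sum>j=1..m. X j) + U"
    proof -
      have "(\<Sum>j=1..m. (if j = Suc m then U else X j)) = (\<Sum>j=1..m. X j)"
        by (intro sum.cong) auto
      then show ?thesis by simp
    qed
    moreover have "(\<Sum>j=1..Suc m. if j = 1 then L else X (j - 1)) = L + (\<Sum>j=1..m. X j)"
      by (simp add: sum.atLeast_Suc_atMost sum.shift_bounds_cl_Suc_ivl del: sum.cl_ivl_Suc)
    ultimately show ?thesis by (simp add: sum_subtractf del: sum.cl_ivl_Suc)
  qed
  obtain m where m: "r i = Suc m" using r_pos[OF i] by (cases "r i") auto
  have "(\<Sum>j=1..r i. zeta_tilde d r s i j) =
      (\<Sum>j=1..r i. (if j = r i then upper_sum (cyc d (i - 1)) else inner_sum i j)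
        - (if j = 1 then lower_sum i else inner_sum i (j - 1)))"
    unfolding zeta_tilde_def
    by (intro sum.cong refl infsumI has_sum_zeta_tilde_term i)
  also have "\<dots> = upper_sum (cyc d (i - 1)) - lower_sum i"
    unfolding m by (rule tele)
  finally show ?thesis .
qed

lemma has_sum_zeta_cyc_term:
  assumes i: "i \<in> {1..d}"
  shows "(zeta_cyc_term d r s has_sum upper_sum i - lower_sum i) (S_cyc d r i)"
proof -
  define g where "g ns = upper_gap (ns (i, 1)) (ns (next_top d r i)) -
    lower_gap (ns (i, 1)) (ns (next_top d r i))" for ns
  have g_closed: "g ns = harm (ns (next_top d r i)) - harm (ns (i, 1) - 1)" if "ns \<in> closed_tuples d r" for ns
    using closed_tuples_le[OF that i] by (simp add: g_def upper_gap_diff_lower_gap)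
  have abs_summable: "(\<lambda>ns. weight ns * of_real (h ns)) summable_on linked d r i"
    if "\<And>ns. 0 \<le> h ns \<and> h ns \<le> upper_gap (ns (i, 1)) (ns (next_top d r i))" for h
  proof (rule abs_summable_summable)
    have "norm (weight ns * of_real (h ns)) = norm (weight ns) * h ns" for ns
      using that by (simp add: norm_mult)
    then show "(\<lambda>ns. norm (weight ns * of_real (h ns))) summable_on linked d r i"
      using summable_on_linked[OF i subset_refl that] by simp
  qed
  have "((\<lambda>(ns, n). weight ns * of_real (1 / real n)) has_sum
      (\<Sum>\<^sub>\<infinity>ns\<in>closed_tuples d r. weight ns * of_real (g ns))) (S_cyc d r i)"
    unfolding S_cyc_eq[OF i]
  proof (rule has_sum_Sigma_weighted)
    fix ns assume ns: "ns \<in> closed_tuples d r"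
    then have "ns (i, 1) \<ge> 1"
      using increasing_tuples_ge_1[of ns d r "(i, 1)"] i r_pos[OF i] by (auto simp: closed_tuples_def idx_def)
    then show "((\<lambda>n. 1 / real n) has_sum g ns) {n. ns (i, 1) \<le> n \<and> n \<le> ns (next_top d r i)}"
      using has_sum_harm_interval closed_tuples_le[OF ns i] g_closed[OF ns] by simp
  next
    show "(\<lambda>ns. norm (weight ns) * g ns) summable_on closed_tuples d r"
      by (rule summable_on_linked[OF i closed_subset_linked])
         (auto simp: g_def lower_gap_nonneg lower_gap_le_upper_gap)
  qed auto
  \<comment> \<open>On linked tuples that are not closed the two gaps coincide, so \<open>g\<close>
    vanishes there and the sum extends to the common base of \<open>upper_sum\<close> and
    \<open>lower_sum\<close>.\<close>
  also have "(\<Sum>\<^sub>\<infinity>ns\<in>closed_tuples d r. weight ns * of_real (g ns))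
      = (\<Sum>\<^sub>\<infinity>ns\<in>linked d r i. weight ns * of_real (g ns))"
    by (rule infsum_cong_neutral)
       (auto simp: closed_tuples_eq[OF i] g_def upper_gap_diff_lower_gap)
  also have "\<dots> = upper_sum i - lower_sum i"
  proof (rule infsumI)
    have "((\<lambda>ns. weight ns * of_real (upper_gap (ns (i, 1)) (ns (next_top d r i))) -
        weight ns * of_real (lower_gap (ns (i, 1)) (ns (next_top d r i)))) has_sum
        upper_sum i - lower_sum i) (linked d r i)"
      unfolding upper_sum_def lower_sum_def
      by (intro has_sum_diff has_sum_infsum abs_summable)
         (simp_all add: upper_gap_nonneg lower_gap_nonneg lower_gap_le_upper_gap)
    then show "((\<lambda>ns. weight ns * of_real (g ns)) has_sum upper_sum i - lower_sum i) (linked d r i)"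
      by (simp add: g_def right_diff_distrib)
  qed
  also have "(\<lambda>(ns, n). weight ns * of_real (1 / real n)) = zeta_cyc_term d r s"
    by (auto simp: zeta_cyc_term_def weight_def fun_eq_iff)
  finally show ?thesis .
qed

text \<open>The predecessor map permutes the blocks. Reindexing puts the upper and the lower
  contribution of one link under the same index.\<close>

lemma sum_upper_sum_pred: "(\<Sum>i=1..d. upper_sum (cyc d (i - 1))) = (\<Sum>i=1..d. upper_sum i)"
proof (rule sum.reindex_bij_witness[of _ "\<lambda>k. cyc d (k + 1)" "\<lambda>i. cyc d (i - 1)"])
  show "cyc d (cyc d (k + 1) - 1) = k" if "k \<in> {1..d}" for k
  proof -
    have "fst (next_top d r k) = cyc d (k + 1)" by (simp add: next_top_def)
    then show ?thesis
      using fst_next_top_eq_iff[OF cyc_in[OF d_pos] that] by metis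
  qed
qed (auto simp only: cyc_pred cyc_in[OF d_pos] pred_in)

end

theorem theorem1p2:
  fixes d :: nat and r :: "nat \<Rightarrow> nat" and s :: "nat \<times> nat \<Rightarrow> complex"
  assumes "d \<ge> 1"
    and "\<forall>i\<in>{1..d}. r i \<ge> 1"
    and "s \<in> W d r"
  shows "(\<forall>i\<in>{1..d}. \<forall>j\<in>{1..r i}. zeta_tilde_term d r s i j summable_on S_tilde d r i j) \<and>
    (\<forall>i\<in>{1..d}. zeta_cyc_term d r s summable_on S_cyc d r i) \<and>
    (\<Sum>i=1..d. \<Sum>j=1..r i. zeta_tilde d r s i j) = (\<Sum>i=1..d. zeta_cyc d r s i)"
proof -
  interpret cyclic_sum d r s
    using assms by unfold_locales auto
  have "(\<Sum>i=1..d. \<Sum>j=1..r i. zeta_tilde d r s i j) = (\<Sum>i=1..d. upper_sum (cyc d (i - 1)) - lower_sum i)"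
    by (intro sum.cong refl sum_zeta_tilde)
  also have "\<dots> = (\<Sum>i=1..d. upper_sum i - lower_sum i)"
    by (simp only: sum_subtractf sum_upper_sum_pred)
  also have "\<dots> = (\<Sum>i=1..d. zeta_cyc d r s i)"
    unfolding zeta_cyc_def by (intro sum.cong refl infsumI[symmetric] has_sum_zeta_cyc_term)
  finally show ?thesis
    using has_sum_zeta_tilde_term has_sum_zeta_cyc_term has_sum_imp_summable by blast
qed

end
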